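(* Let $N\le 4$ and let $A\in\mathbb{R}^{N\times N}$ satisfy the standing assumptions given in the context. Let $(\alpha,\beta)$ be an admissible parameter pair (see context) satisfying in addition $$d_3d_4-n_3n_4\le 0,\qquad n_3^2-d_3^2\le 0,\qquad n_1n_4-n_2n_3-d_1d_4+d_2d_3\le 0,$$ $$n_2^2-d_2^2-2n_4+2d_4\le 0,\qquad -n_1n_2+d_1d_2+n_3-d_3\le 0,$$ where $n_j,d_j$ are the functions of $(\alpha,\beta)$ given in the context. 1. Let $y^*>0$ be a positive steady state of the differential equation $y'=Ay$, i.e. $Ay^*=0$. Then $y^*$ is a (Lyapunov) stable fixed point of the MPRK43($\alpha,\beta$) scheme applied to $y'=Ay$ for all $\Delta t>0$. 2. Let $y^*>0$ be the unique steady state of the initial value problem $y'=Ay$, $y(0)=y^0>0$. If $y^0$ is close enough to $y^*$, then the MPRK43($\alpha,\beta$) iterates started at $y^0$ converge to $y^*$ for all $\Delta t>0$; that is, for each $\Delta t>0$ there is a $\delta>0$ such that $\|y^0-y^*\|<\delta$ implies $y^n\to y^*$ as $n\to\infty$.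
   Context: Inequalities between vectors are componentwise; $\operatorname{diag}(v)$ is the diagonal matrix with diagonal $v$, and real powers of positive diagonal matrices are taken entrywise on the diagonal. Standing assumptions on $A$: $A\ne 0$; all off-diagonal entries of $A$ are nonnegative; $(1,\dots,1)^T\in\ker(A^T)$; the eigenvalue $0$ of $A$ has equal algebraic and geometric multiplicity $k\ge 1$; every eigenvalue $\lambda$ of $A$ satisfies $\operatorname{Re}(\lambda)\le 0$. Steady state of the initial value problem: the unique vector $y^*$ with $Ay^*=0$ and $n^Ty^*=n^Ty^0$ for all $n\in\ker(A^T)$. Admissible parameters: $\alpha\neq\beta$ and one of (i) $\tfrac13\le\alpha<\tfrac23$ and $\tfrac23\le\beta\le 3\alpha(1-\alpha)$; (ii) $\tfrac23\le\alpha<\alpha_0$ and $3\alpha(1-\alpha)\le\beta\le\tfrac23$; (iii) $\alpha>\alpha_0$ and $\tfrac{3\alpha-2}{6\alpha-3}\le\beta\le\tfrac23$. Here $\alpha_0\approx 0.89255$ is the real number with $3\alpha_0(1-\alpha_0)=\tfrac{3\alpha_0-2}{6\alpha_0-3}$, i.e. the unique real root of $18x^3-27x^2+12x-2$. The functions $n_j,d_j$: $n_1=-(1+\alpha+\beta)$, $n_2=\frac{-6(1+\beta)\alpha^3+(6\beta^2+3)\alpha^2+(6\beta^2-3\beta+1)\alpha+2(\beta-1)}{6\alpha(\beta-\alpha)}$, $n_3=\frac{(6\beta-3)\alpha^3+(6\beta^2+1)\alpha^2+(3\beta^2+\beta-1)\alpha-2(\beta-1)}{6\alpha(\beta-\alpha)}$,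 $n_4=-\left(\tfrac16+(\beta-\tfrac12)\alpha\right)$, $d_1=-(\alpha+\beta+2)$, $d_2=(\beta+2)\alpha+2\beta+1$, $d_3=-(\alpha+\beta+2\alpha\beta)$, $d_4=\alpha\beta$. The MPRK43($\alpha,\beta$) scheme: put $a_{21}=\alpha$, $a_{31}=\frac{3\alpha\beta(1-\alpha)-\beta^2}{\alpha(2-3\alpha)}$, $a_{32}=\frac{\beta(\beta-\alpha)}{\alpha(2-3\alpha)}$, $b_1=1+\frac{2-3(\alpha+\beta)}{6\alpha\beta}$, $b_2=\frac{3\beta-2}{6\alpha(\beta-\alpha)}$, $b_3=\frac{2-3\alpha}{6\beta(\beta-\alpha)}$, $p=3a_{21}(a_{31}+a_{32})b_3$, $q=a_{21}$, $\beta_2=\frac{1}{2a_{21}}$, $\beta_1=1-\beta_2$. With step size $\Delta t>0$, applied to $y'=Ay$ (written as a production-destruction system with $p_{ij}(y)=d_{ji}(y)=a_{ij}y_j$ for $i\neq j$, where here $a_{ij}$ are the entries of $A$, and $p_{ii}=d_{ii}=0$), it maps $y^n>0$ to $y^{n+1}=g(y^n)$ by successively solving the linear systems $$y^{(1)}=y^n+a_{21}\Delta t\,A\,y^{(1)},$$ $$y^{(2)}=y^n+\Delta t\,A\operatorname{diag}(y^{(2)})\operatorname{diag}(y^{(1)})^{-1/p}\operatorname{diag}(y^n)^{1/p-1}\left(a_{31}y^n+a_{32}y^{(1)}\right),$$ $$y^{(3)}=y^n+\Delta t\,A\operatorname{diag}(y^{(3)})\operatorname{diag}(y^{(1)})^{-1/q}\operatorname{diag}(y^n)^{1/q-1}\left(\beta_1y^n+\beta_2y^{(1)}\right),$$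 $$y^{n+1}=y^n+\Delta t\,A\operatorname{diag}(y^{n+1})\operatorname{diag}(y^{(3)})^{-1}\left(b_1y^n+b_2y^{(1)}+b_3y^{(2)}\right).$$ The map $g$ is considered on positive vectors for which these systems are uniquely solvable with positive solutions; the statements include that the iterates considered are defined. A fixed point $y^*=g(y^* )$ is (Lyapunov) stable if for every $\epsilon>0$ there is $\delta>0$ such that $\|y^0-y^*\|<\delta$ implies $\|y^n-y^*\|<\epsilon$ for all $n\ge 0$. *)

theory Defs
  imports "HOL-Analysis.Analysis" "HOL-Computational_Algebra.Polynomial"
begin

(* The library order on real ^ 'n makes x < y strict in at least one component only,
   so componentwise strict positivity needs its own predicate. *)
definition vpos :: "real ^ 'n \<Rightarrow> bool" where
  "vpos y \<longleftrightarrow> (\<forall>i. 0 < y $ i)"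

definition diag :: "real ^ 'n \<Rightarrow> real ^ 'n ^ 'n" where
  "diag v = (\<chi> i j. if i = j then v $ i else 0)"

definition diag_powr :: "real ^ 'n \<Rightarrow> real \<Rightarrow> real ^ 'n ^ 'n" where
  "diag_powr v s = diag (\<chi> i. v $ i powr s)"

section \<open>Eigenvalues and their multiplicities\<close>

definition eigenvalue :: "'a::field ^ 'n ^ 'n \<Rightarrow> 'a \<Rightarrow> bool" where
  "eigenvalue M l \<longleftrightarrow> (\<exists>v. v \<noteq> 0 \<and> M *v v = l *s v)"

definition char_poly :: "'a::field ^ 'n ^ 'n \<Rightarrow> 'a poly" where
  "char_poly M = det (\<chi> i j. (if i = j then [:0, 1:] else 0) - [:M $ i $ j:])"

definition alg_mult :: "'a::field ^ 'n ^ 'n \<Rightarrow> 'a \<Rightarrow> nat" where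
  "alg_mult M l = order l (char_poly M)"

definition geo_mult :: "'a::field ^ 'n ^ 'n \<Rightarrow> 'a \<Rightarrow> nat" where
  "geo_mult M l = vec.dim {v. M *v v = l *s v}"

(* The hypothesis on the real parts concerns all complex eigenvalues of the real matrix A,
   hence map_matrix complex_of_real. *)
definition standing_assumptions :: "real ^ 'n ^ 'n \<Rightarrow> bool" where
  "standing_assumptions A \<longleftrightarrow>
     A \<noteq> 0 \<and>
     (\<forall>i j. i \<noteq> j \<longrightarrow> 0 \<le> A $ i $ j) \<and>
     transpose A *v 1 = 0 \<and>
     (\<exists>k\<ge>1. alg_mult A 0 = k \<and> geo_mult A 0 = k) \<and>
     (\<forall>l. eigenvalue (map_matrix complex_of_real A) l \<longrightarrow> Re l \<le> 0)"

(* y is the one and only vector in ker A that has the same linear invariants as y0. *)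
definition ivp_steady_state :: "real ^ 'n ^ 'n \<Rightarrow> real ^ 'n \<Rightarrow> real ^ 'n \<Rightarrow> bool" where
  "ivp_steady_state A y0 y \<longleftrightarrow>
     (\<forall>z. (A *v z = 0 \<and> (\<forall>n. transpose A *v n = 0 \<longrightarrow> n \<bullet> z = n \<bullet> y0)) \<longleftrightarrow> z = y)"

section \<open>Parameters\<close>

definition alpha0 :: real where
  "alpha0 = (THE x. 3 * x * (1 - x) = (3 * x - 2) / (6 * x - 3))"

lemma alpha0_cubic_iff:
  fixes x :: real
  shows "3 * x * (1 - x) = (3 * x - 2) / (6 * x - 3)
     \<longleftrightarrow> 18 * x ^ 3 - 27 * x ^ 2 + 12 * x - 2 = 0"
proof (cases "6 * x - 3 = 0")
  case True
  then have "x = 1 / 2" by simp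
  then show ?thesis unfolding \<open>x = 1 / 2\<close> by (simp add: power2_eq_square power3_eq_cube)
next
  case False
  have "3 * x * (1 - x) * (6 * x - 3) - (3 * x - 2)
      = - (18 * x ^ 3 - 27 * x ^ 2 + 12 * x - 2)"
    by (simp add: power2_eq_square power3_eq_cube algebra_simps)
  with False show ?thesis by (auto simp: eq_divide_eq)
qed

lemma alpha0_unique:
  "\<exists>!x::real. 18 * x ^ 3 - 27 * x ^ 2 + 12 * x - 2 = 0"
  "\<exists>x::real. 0.8925 < x \<and> x < 0.8926 \<and> 18 * x ^ 3 - 27 * x ^ 2 + 12 * x - 2 = 0"
proof -
  let ?f = "\<lambda>x::real. 18 * x ^ 3 - 27 * x ^ 2 + 12 * x - 2"
  have "\<exists>x. 0.8925 \<le> x \<and> x \<le> 0.8926 \<and> ?f x = 0"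
    by (rule IVT') (auto intro!: continuous_intros simp: power2_eq_square power3_eq_cube)
  then obtain r where r: "0.8925 \<le> r" "r \<le> 0.8926" "?f r = 0" by blast
  have "?f 0.8925 \<noteq> 0" "?f 0.8926 \<noteq> 0"
    by (simp_all add: power2_eq_square power3_eq_cube)
  then have "r \<noteq> 0.8925" "r \<noteq> 0.8926"
    using r(3) by metis+
  with r show "\<exists>x::real. 0.8925 < x \<and> x < 0.8926 \<and> ?f x = 0" by force
  have "x = r" if x: "?f x = 0" for x
  proof (rule ccontr)
    assume ne: "x \<noteq> r"
    have "?f x - ?f r = (x - r) * (18 * (x ^ 2 + x * r + r ^ 2) - 27 * (x + r) + 12)"
      by (simp add: power2_eq_square power3_eq_cube algebra_simps)
    with x r(3) ne have z: "18 * (x ^ 2 + x * r + r ^ 2) - 27 * (x + r) + 12 = 0" by simp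
    have sq: "18 * (x ^ 2 + x * r + r ^ 2) - 27 * (x + r) + 12
        = 18 * (x + r / 2 - 3 / 4) ^ 2 + 27 / 2 * r * (r - 1) + 15 / 8"
      by (simp add: power2_eq_square field_simps)
    have "r * (1 - r) \<le> 0.8926 * 0.1075" using r by (intro mult_mono) auto
    then have "27 / 2 * r * (r - 1) + 15 / 8 > 0" by (simp add: field_simps)
    moreover have "18 * (x + r / 2 - 3 / 4) ^ 2 \<ge> 0" by simp
    ultimately show False using z sq by linarith
  qed
  with r(3) show "\<exists>!x. ?f x = 0" by blast
qed

lemma alpha0_root:
  "3 * alpha0 * (1 - alpha0) = (3 * alpha0 - 2) / (6 * alpha0 - 3)"
  "0.8925 < alpha0" "alpha0 < 0.8926"
proof -
  show eq: "3 * alpha0 * (1 - alpha0) = (3 * alpha0 - 2) / (6 * alpha0 - 3)"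
    unfolding alpha0_def by (rule theI') (simp only: alpha0_cubic_iff alpha0_unique)
  show "0.8925 < alpha0" "alpha0 < 0.8926"
    using eq alpha0_unique unfolding alpha0_cubic_iff by blast+
qed

definition admissible :: "real \<Rightarrow> real \<Rightarrow> bool" where
  "admissible \<alpha> \<beta> \<longleftrightarrow> \<alpha> \<noteq> \<beta> \<and>
     ((1/3 \<le> \<alpha> \<and> \<alpha> < 2/3 \<and> 2/3 \<le> \<beta> \<and> \<beta> \<le> 3 * \<alpha> * (1 - \<alpha>)) \<or>
      (2/3 \<le> \<alpha> \<and> \<alpha> < alpha0 \<and> 3 * \<alpha> * (1 - \<alpha>) \<le> \<beta> \<and> \<beta> \<le> 2/3) \<or>
      (alpha0 < \<alpha> \<and> (3 * \<alpha> - 2) / (6 * \<alpha> - 3) \<le> \<beta> \<and> \<beta> \<le> 2/3))"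

definition n1 :: "real \<Rightarrow> real \<Rightarrow> real" where
  "n1 \<alpha> \<beta> = - (1 + \<alpha> + \<beta>)"

definition n2 :: "real \<Rightarrow> real \<Rightarrow> real" where
  "n2 \<alpha> \<beta> =
     (- 6 * (1 + \<beta>) * \<alpha> ^ 3 + (6 * \<beta> ^ 2 + 3) * \<alpha> ^ 2 + (6 * \<beta> ^ 2 - 3 * \<beta> + 1) * \<alpha> + 2 * (\<beta> - 1))
     / (6 * \<alpha> * (\<beta> - \<alpha>))"

definition n3 :: "real \<Rightarrow> real \<Rightarrow> real" where
  "n3 \<alpha> \<beta> =
     ((6 * \<beta> - 3) * \<alpha> ^ 3 + (6 * \<beta> ^ 2 + 1) * \<alpha> ^ 2 + (3 * \<beta> ^ 2 + \<beta> - 1) * \<alpha> - 2 * (\<beta> - 1))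
     / (6 * \<alpha> * (\<beta> - \<alpha>))"

definition n4 :: "real \<Rightarrow> real \<Rightarrow> real" where
  "n4 \<alpha> \<beta> = - (1/6 + (\<beta> - 1/2) * \<alpha>)"

definition d1 :: "real \<Rightarrow> real \<Rightarrow> real" where
  "d1 \<alpha> \<beta> = - (\<alpha> + \<beta> + 2)"

definition d2 :: "real \<Rightarrow> real \<Rightarrow> real" where
  "d2 \<alpha> \<beta> = (\<beta> + 2) * \<alpha> + 2 * \<beta> + 1"

definition d3 :: "real \<Rightarrow> real \<Rightarrow> real" where
  "d3 \<alpha> \<beta> = - (\<alpha> + \<beta> + 2 * \<alpha> * \<beta>)"

definition d4 :: "real \<Rightarrow> real \<Rightarrow> real" where
  "d4 \<alpha> \<beta> = \<alpha> * \<beta>"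

section \<open>The scheme\<close>

definition a21 :: "real \<Rightarrow> real \<Rightarrow> real" where
  "a21 \<alpha> \<beta> = \<alpha>"

definition a31 :: "real \<Rightarrow> real \<Rightarrow> real" where
  "a31 \<alpha> \<beta> = (3 * \<alpha> * \<beta> * (1 - \<alpha>) - \<beta> ^ 2) / (\<alpha> * (2 - 3 * \<alpha>))"

definition a32 :: "real \<Rightarrow> real \<Rightarrow> real" where
  "a32 \<alpha> \<beta> = \<beta> * (\<beta> - \<alpha>) / (\<alpha> * (2 - 3 * \<alpha>))"

definition b1 :: "real \<Rightarrow> real \<Rightarrow> real" where
  "b1 \<alpha> \<beta> = 1 + (2 - 3 * (\<alpha> + \<beta>)) / (6 * \<alpha> * \<beta>)"

definition b2 :: "real \<Rightarrow> real \<Rightarrow> real" where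
  "b2 \<alpha> \<beta> = (3 * \<beta> - 2) / (6 * \<alpha> * (\<beta> - \<alpha>))"

definition b3 :: "real \<Rightarrow> real \<Rightarrow> real" where
  "b3 \<alpha> \<beta> = (2 - 3 * \<alpha>) / (6 * \<beta> * (\<beta> - \<alpha>))"

definition mprk_p :: "real \<Rightarrow> real \<Rightarrow> real" where
  "mprk_p \<alpha> \<beta> = 3 * a21 \<alpha> \<beta> * (a31 \<alpha> \<beta> + a32 \<alpha> \<beta>) * b3 \<alpha> \<beta>"

definition mprk_q :: "real \<Rightarrow> real \<Rightarrow> real" where
  "mprk_q \<alpha> \<beta> = a21 \<alpha> \<beta>"

definition beta2 :: "real \<Rightarrow> real \<Rightarrow> real" where
  "beta2 \<alpha> \<beta> = 1 / (2 * a21 \<alpha> \<beta>)"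

definition beta1 :: "real \<Rightarrow> real \<Rightarrow> real" where
  "beta1 \<alpha> \<beta> = 1 - beta2 \<alpha> \<beta>"

(* Uniqueness is among all vectors, not only among the positive ones. *)
definition unique_pos_solution :: "(real ^ 'n \<Rightarrow> bool) \<Rightarrow> real ^ 'n \<Rightarrow> bool" where
  "unique_pos_solution P x \<longleftrightarrow> vpos x \<and> (\<forall>z. P z \<longleftrightarrow> z = x)"

(* The graph of the partial map g: y and y' are related iff y > 0, each of the four linear
   systems has exactly one solution, these solutions are positive, and the last one is y'. *)
definition mprk43_step ::
  "real \<Rightarrow> real \<Rightarrow> real \<Rightarrow> real ^ 'n ^ 'n \<Rightarrow> real ^ 'n \<Rightarrow> real ^ 'n \<Rightarrow> bool" where
  "mprk43_step \<alpha> \<beta> dt A y y' \<longleftrightarrow>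
     vpos y \<and>
     (\<exists>y1 y2 y3.
        unique_pos_solution
          (\<lambda>x. x = y + (a21 \<alpha> \<beta> * dt) *\<^sub>R (A *v x)) y1 \<and>
        unique_pos_solution
          (\<lambda>x. x = y + dt *\<^sub>R ((A ** diag x ** diag_powr y1 (- (1 / mprk_p \<alpha> \<beta>))
                                  ** diag_powr y (1 / mprk_p \<alpha> \<beta> - 1))
                                *v (a31 \<alpha> \<beta> *\<^sub>R y + a32 \<alpha> \<beta> *\<^sub>R y1))) y2 \<and>
        unique_pos_solution
          (\<lambda>x. x = y + dt *\<^sub>R ((A ** diag x ** diag_powr y1 (- (1 / mprk_q \<alpha> \<beta>))
                                  ** diag_powr y (1 / mprk_q \<alpha> \<beta> - 1))
                                *v (beta1 \<alpha> \<beta> *\<^sub>R y + beta2 \<alpha> \<beta> *\<^sub>R y1))) y3 \<and>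
        unique_pos_solution
          (\<lambda>x. x = y + dt *\<^sub>R ((A ** diag x ** diag_powr y3 (- 1))
                                *v (b1 \<alpha> \<beta> *\<^sub>R y + b2 \<alpha> \<beta> *\<^sub>R y1 + b3 \<alpha> \<beta> *\<^sub>R y2))) y')"

definition mprk43_dom :: "real \<Rightarrow> real \<Rightarrow> real \<Rightarrow> real ^ 'n ^ 'n \<Rightarrow> (real ^ 'n) set" where
  "mprk43_dom \<alpha> \<beta> dt A = {y. \<exists>y'. mprk43_step \<alpha> \<beta> dt A y y'}"

(* Meaningful only on mprk43_dom. *)
definition mprk43_map :: "real \<Rightarrow> real \<Rightarrow> real \<Rightarrow> real ^ 'n ^ 'n \<Rightarrow> real ^ 'n \<Rightarrow> real ^ 'n" where
  "mprk43_map \<alpha> \<beta> dt A y = (THE y'. mprk43_step \<alpha> \<beta> dt A y y')"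

lemma unique_pos_solution_unique:
  "unique_pos_solution P x \<Longrightarrow> unique_pos_solution P z \<Longrightarrow> x = z"
  by (auto simp: unique_pos_solution_def)

lemma mprk43_step_unique:
  assumes "mprk43_step \<alpha> \<beta> dt A y u" and "mprk43_step \<alpha> \<beta> dt A y v"
  shows "u = v"
  using assms unfolding mprk43_step_def
  by (elim conjE exE) (drule (1) unique_pos_solution_unique, simp)+

lemma mprk43_map_eqI: "mprk43_step \<alpha> \<beta> dt A y u \<Longrightarrow> mprk43_map \<alpha> \<beta> dt A y = u"
  unfolding mprk43_map_def by (blast intro: mprk43_step_unique)

section \<open>Stability of fixed points of a partial map\<close>

(* g is a partial map with domain D; all iterates are required to lie in D, i.e. to be
   defined together with their successors. *)
definition stable_fixed_point ::
  "(real ^ 'n) set \<Rightarrow> (real ^ 'n \<Rightarrow> real ^ 'n) \<Rightarrow> real ^ 'n \<Rightarrow> bool" where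
  "stable_fixed_point D g ystar \<longleftrightarrow>
     ystar \<in> D \<and> g ystar = ystar \<and>
     (\<forall>\<epsilon>>0. \<exists>\<delta>>0. \<forall>y0. norm (y0 - ystar) < \<delta> \<longrightarrow>
        (\<forall>n. (g ^^ n) y0 \<in> D \<and> norm ((g ^^ n) y0 - ystar) < \<epsilon>))"

end

theory Submission
  imports Defs "HOL-Computational_Algebra.Fundamental_Theorem_Algebra" "HOL-Library.Landau_Symbols"
begin

text \<open>
  Write \<open>Z = dt *\<^sub>R A\<close>. Near a positive equilibrium every stage of the scheme solves \<open>x = y + Z *v (w * x)\<close> for a positive weight
  vector \<open>w\<close>, and \<open>I - Z diag w\<close> has an inverse that does not increase the 1-norm, because the columns
  of \<open>Z\<close> sum to zero and its off-diagonal entries are nonnegative (\<open>resolvent_l1\<close>). So every stage is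
  solvable, and errors pass through a stage without amplification. The same estimate, applied
  to \<open>I - t Z\<close> for large \<open>t\<close>, shows that kernel and range of \<open>A\<close> are complementary. Hence each initial value
  splits as \<open>z + d\<close> with \<open>z\<close> in the kernel and \<open>d\<close> in the range; the scheme changes vectors
  only by elements of the range, and all positive \<open>z\<close> in the kernel are fixed points.

  The weights of a stage depend only on the ratios of stage values to \<open>y\<close>. At every equilibrium
  these ratios are 1, so the linearization of one step at \<open>z\<close> does not depend on \<open>z\<close>: it is
  \<open>R(Z) = N(Z) D(Z)\<^sup>-\<^sup>1\<close> with \<open>D = (1 - \<alpha> X) (1 - \<beta> X) (1 - X)\<^sup>2\<close> and \<open>N\<close> the quartic \<open>stab_num\<close>. The error of this
  linearization is \<open>o(d)\<close> uniformly in \<open>z\<close> near \<open>ystar\<close> (\<open>mprk43_expansion\<close>).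

  It remains to see that the powers of \<open>R(Z)\<close> tend to zero on the range. Two facts are combined.
  A nonzero eigenvalue \<open>l\<close> of a conservative matrix of order at most 4 lies in the sector
  \<open>\<bar>Im l\<bar> \<le> - Re l\<close> (\<open>conservative_eigenvalue_sector\<close>), and \<open>\<bar>N\<bar> < \<bar>D\<bar>\<close> on this sector without 0
  (\<open>stab_num_less_den\<close>). Convergence of the powers follows by splitting off one
  root of an annihilating polynomial of \<open>Z\<close> at a time (\<open>rational_recurrence_tendsto_0\<close>).

  In a norm adapted to \<open>R(Z)\<close> one step then contracts \<open>d\<close>, with the same factor for all
  \<open>z\<close> near \<open>ystar\<close> (\<open>mprk43_orbits\<close>). So the iterates from \<open>z + d\<close> stay close to \<open>z\<close>, hence to \<open>ystar\<close>, and converge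
  to \<open>z\<close>. If \<open>ystar\<close> is the steady state of the initial value problem, then \<open>z = ystar\<close>.
\<close>

section \<open>Conservative matrices\<close>

definition conservative :: "real ^ 'n ^ 'n \<Rightarrow> bool" where
  "conservative Z \<longleftrightarrow> (\<forall>i j. i \<noteq> j \<longrightarrow> 0 \<le> Z $ i $ j) \<and> (\<forall>j. (\<Sum>i\<in>UNIV. Z $ i $ j) = 0)"

definition l1norm :: "real ^ 'n \<Rightarrow> real" where
  "l1norm x = (\<Sum>i\<in>UNIV. \<bar>x $ i\<bar>)"

lemma standing_assumptions_conservative:
  assumes "standing_assumptions A" "0 \<le> t"
  shows "conservative (t *\<^sub>R A)"
proof -
  have "(\<Sum>i\<in>UNIV. A $ i $ j) = 0" for j
    using assms(1) by (auto simp: standing_assumptions_def vec_eq_iff matrix_vector_mult_def transpose_def)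
  then show ?thesis
    using assms by (auto simp: conservative_def standing_assumptions_def simp flip: sum_distrib_left)
qed

lemma conservative_diag_abs:
  assumes "conservative Z"
  shows "(\<Sum>i\<in>UNIV - {j}. Z $ i $ j) = \<bar>Z $ j $ j\<bar>"
proof -
  have "Z $ j $ j + (\<Sum>i\<in>UNIV - {j}. Z $ i $ j) = 0"
    using assms by (subst sum.remove[OF finite UNIV_I, symmetric]) (simp add: conservative_def)
  moreover have "0 \<le> (\<Sum>i\<in>UNIV - {j}. Z $ i $ j)"
    using assms by (intro sum_nonneg) (auto simp: conservative_def)
  ultimately show ?thesis by simp
qed

text \<open>Discrete maximum principle in the 1-norm. Taking absolute values in row \<open>i\<close> keeps the diagonal term,
  whose sign agrees with that of \<open>x $ i\<close>; after summation over the rows the diagonal terms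
  cancel the off-diagonal ones, since the columns of \<open>Z\<close> sum to zero.\<close>
lemma resolvent_l1:
  assumes Z: "conservative Z" and w: "\<And>i. 0 \<le> w $ i" and x: "x - Z *v (w * x) = c"
  shows "l1norm x \<le> l1norm c"
proof -
  have dneg: "\<bar>Z $ i $ i\<bar> = - (Z $ i $ i)" for i
  proof -
    have "Z $ i $ i + (\<Sum>k\<in>UNIV - {i}. Z $ k $ i) = 0"
      using Z by (subst sum.remove[OF finite UNIV_I, symmetric]) (simp add: conservative_def)
    then show ?thesis
      using conservative_diag_abs[OF Z, of i] by simp
  qed
  have row: "\<bar>x $ i\<bar> + \<bar>Z $ i $ i\<bar> * (w $ i * \<bar>x $ i\<bar>)
      \<le> \<bar>c $ i\<bar> + (\<Sum>j\<in>UNIV - {i}. Z $ i $ j * (w $ j * \<bar>x $ j\<bar>))" for i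
  proof -
    have "x $ i - (\<Sum>j\<in>UNIV. Z $ i $ j * (w $ j * x $ j)) = c $ i"
      using x by (auto simp: vec_eq_iff matrix_vector_mult_def)
    then have "x $ i + \<bar>Z $ i $ i\<bar> * (w $ i * x $ i)
        = c $ i + (\<Sum>j\<in>UNIV - {i}. Z $ i $ j * (w $ j * x $ j))"
      unfolding sum.remove[OF finite UNIV_I, of "\<lambda>j. Z $ i $ j * (w $ j * x $ j)" i] dneg
      by linarith
    moreover have "\<bar>x $ i + \<bar>Z $ i $ i\<bar> * (w $ i * x $ i)\<bar> = \<bar>x $ i\<bar> + \<bar>Z $ i $ i\<bar> * (w $ i * \<bar>x $ i\<bar>)"
    proof -
      have "x $ i + \<bar>Z $ i $ i\<bar> * (w $ i * x $ i) = (1 + \<bar>Z $ i $ i\<bar> * w $ i) * x $ i"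
        by (simp add: algebra_simps)
      then have "\<bar>x $ i + \<bar>Z $ i $ i\<bar> * (w $ i * x $ i)\<bar> = (1 + \<bar>Z $ i $ i\<bar> * w $ i) * \<bar>x $ i\<bar>"
        using w[of i] by (simp only: abs_mult) simp
      then show ?thesis
        by (simp add: algebra_simps)
    qed
    moreover have "\<bar>\<Sum>j\<in>UNIV - {i}. Z $ i $ j * (w $ j * x $ j)\<bar>
        \<le> (\<Sum>j\<in>UNIV - {i}. Z $ i $ j * (w $ j * \<bar>x $ j\<bar>))"
      using Z w by (intro order.trans[OF sum_abs] sum_mono) (auto simp: abs_mult conservative_def)
    ultimately show ?thesis by linarith
  qed
  have "(\<Sum>i\<in>UNIV. \<Sum>j\<in>UNIV - {i}. Z $ i $ j * (w $ j * \<bar>x $ j\<bar>))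
      = (\<Sum>j\<in>UNIV. \<Sum>i\<in>UNIV - {j}. Z $ i $ j * (w $ j * \<bar>x $ j\<bar>))"
    using sum.swap[of "\<lambda>i j. Z $ i $ j * (w $ j * \<bar>x $ j\<bar>)" UNIV UNIV]
    by (simp add: sum_diff1 sum_subtractf)
  also have "\<dots> = (\<Sum>j\<in>UNIV. \<bar>Z $ j $ j\<bar> * (w $ j * \<bar>x $ j\<bar>))"
    by (simp add: conservative_diag_abs[OF Z] flip: sum_distrib_right)
  finally have sw: "(\<Sum>i\<in>UNIV. \<Sum>j\<in>UNIV - {i}. Z $ i $ j * (w $ j * \<bar>x $ j\<bar>))
      = (\<Sum>j\<in>UNIV. \<bar>Z $ j $ j\<bar> * (w $ j * \<bar>x $ j\<bar>))" .
  have "(\<Sum>i\<in>UNIV. \<bar>x $ i\<bar> + \<bar>Z $ i $ i\<bar> * (w $ i * \<bar>x $ i\<bar>))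
      \<le> (\<Sum>i\<in>UNIV. \<bar>c $ i\<bar> + (\<Sum>j\<in>UNIV - {i}. Z $ i $ j * (w $ j * \<bar>x $ j\<bar>)))"
    by (intro sum_mono row)
  then show ?thesis
    by (simp add: sum.distrib sw l1norm_def)
qed

lemma l1norm_eq_0:
  assumes "l1norm x \<le> 0"
  shows "x = 0"
proof -
  have "\<bar>x $ i\<bar> \<le> l1norm x" for i
    unfolding l1norm_def by (rule member_le_sum) auto
  then show ?thesis
    using assms order.trans by (fastforce simp: vec_eq_iff)
qed

definition const_vec :: "real \<Rightarrow> real ^ 'n" where
  "const_vec s = (\<chi> i. s)"

lemma mult_const_vec: "Z *v (const_vec s * v) = s *s (Z *v v)"
  by (simp add: const_vec_def vec_eq_iff matrix_vector_mult_def sum_distrib_left algebra_simps)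

lemma mult_vec_distrib:
  fixes a b c :: "real ^ 'n"
  shows "a * (b + c) = a * b + a * c" "(a + b) * c = a * c + b * c"
    "a * (b - c) = a * b - a * c" "(a - b) * c = a * c - b * c"
  by (simp_all add: vec_eq_iff algebra_simps)

lemma patankar_ex1:
  assumes Z: "conservative Z" and w: "\<And>i. 0 \<le> w $ i"
  shows "\<exists>!x. x = y + Z *v (w * x)"
proof -
  let ?f = "\<lambda>x. x - Z *v (w * x)"
  have lin: "linear ?f"
    by (intro linearI)
       (simp_all add: vec_eq_iff matrix_vector_mult_def sum_distrib_left sum.distrib algebra_simps)
  have "inj ?f"
  proof (subst linear_injective_0[OF lin], intro allI impI)
    fix x assume "?f x = 0"
    from resolvent_l1[OF Z w this] show "x = 0"
      by (intro l1norm_eq_0) (simp add: l1norm_def)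
  qed
  then have "bij ?f"
    using lin linear_injective_imp_surjective[of ?f] by (auto simp: bij_def)
  then have "\<exists>!x. ?f x = y"
    by (simp add: bij_iff)
  then show ?thesis
    by (simp only: diff_eq_eq)
qed

text \<open>The eigenvalue 0 is semisimple. If \<open>v = Z *v u\<close> lies in the kernel, then \<open>I - t Z\<close> maps \<open>u + t v\<close> to \<open>u\<close>,
  so these vectors are bounded in the 1-norm for all \<open>t > 0\<close>, which forces \<open>v = 0\<close>.\<close>
lemma conservative_ker_range:
  assumes Z: "conservative Z" and v: "v = Z *v u" "Z *v v = 0"
  shows "v = 0"
proof -
  have bound: "t * l1norm v \<le> 2 * l1norm u" if t: "0 < t" for t
  proof -
    have "(u + t *\<^sub>R v) - Z *v ((\<chi> i. t) * (u + t *\<^sub>R v)) = u"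
    proof -
      have "(\<chi> i. t) * (u + t *\<^sub>R v) = t *\<^sub>R u + (t * t) *\<^sub>R v"
        by (simp add: vec_eq_iff algebra_simps)
      then show ?thesis
        using v by (simp add: algebra_simps matrix_vector_mult_scaleR)
    qed
    from resolvent_l1[OF Z _ this] have "l1norm (u + t *\<^sub>R v) \<le> l1norm u"
      using t by simp
    moreover have "t * l1norm v \<le> l1norm (u + t *\<^sub>R v) + l1norm u"
      unfolding l1norm_def sum_distrib_left sum.distrib[symmetric]
    proof (rule sum_mono)
      fix i
      have "t * \<bar>v $ i\<bar> = \<bar>t * v $ i\<bar>"
        using t by (simp add: abs_mult)
      then show "t * \<bar>v $ i\<bar> \<le> \<bar>(u + t *\<^sub>R v) $ i\<bar> + \<bar>u $ i\<bar>"
        by simp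
    qed
    ultimately show ?thesis by simp
  qed
  have "l1norm v \<le> 0"
  proof (rule ccontr)
    assume "\<not> l1norm v \<le> 0"
    then have pos: "0 < l1norm v" by simp
    \<comment> \<open>The value \<open>t = (2 * l1norm u + 1) / l1norm v\<close> violates the bound.\<close>
    have "0 \<le> l1norm u" by (simp add: l1norm_def sum_nonneg)
    then have "(2 * l1norm u + 1) / l1norm v * l1norm v \<le> 2 * l1norm u"
      using pos by (intro bound) simp
    with pos show False by simp
  qed
  then show ?thesis by (rule l1norm_eq_0)
qed

section \<open>Eigenvalues of conservative matrices of order at most four\<close>

text \<open>The half-planes \<open>Re \<ge> 1\<close> and \<open>Re > 1\<close> are closed under a suitable branch of the geometric mean: with the principal
  square roots \<open>p\<close> and \<open>q\<close> this is the inequality of Aczel,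
  \<open>(Re p Re q - Im p Im q)\<^sup>2 \<ge> ((Re p)\<^sup>2 - (Im p)\<^sup>2) ((Re q)\<^sup>2 - (Im q)\<^sup>2)\<close>.\<close>
lemma geometric_mean_Re:
  fixes a b :: complex
  assumes a: "1 \<le> Re a" and b: "1 \<le> Re b"
  obtains c where "c\<^sup>2 = a * b" "1 \<le> Re c" "1 < Re a \<or> 1 < Re b \<Longrightarrow> 1 < Re c"
proof -
  define p q where "p = csqrt a" and "q = csqrt b"
  have pa: "Re a = (Re p)\<^sup>2 - (Im p)\<^sup>2" and qb: "Re b = (Re q)\<^sup>2 - (Im q)\<^sup>2"
    using Re_power2[of p] Re_power2[of q] by (simp_all add: p_def q_def)
  have nonneg: "0 \<le> Re p" "0 \<le> Re q"
    using a b by (simp_all add: p_def q_def add_nonneg_nonneg)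
  have "\<bar>Im p\<bar> < Re p" "\<bar>Im q\<bar> < Re q"
    using pa qb a b nonneg abs_le_square_iff[of "Re p" "Im p"] abs_le_square_iff[of "Re q" "Im q"]
    by (auto simp: not_le[symmetric])
  then have "\<bar>Im p\<bar> * \<bar>Im q\<bar> < Re p * Re q"
    by (intro mult_strict_mono') auto
  then have pos: "0 < Re (p * q)"
    by (simp add: abs_mult[symmetric])
  have "(Re (p * q))\<^sup>2 = Re a * Re b + (Re p * Im q - Im p * Re q)\<^sup>2"
    by (simp add: pa qb power2_eq_square algebra_simps)
  then have sq: "Re a * Re b \<le> (Re (p * q))\<^sup>2"
    by simp
  show thesis
  proof
    show "(p * q)\<^sup>2 = a * b"
      by (simp add: p_def q_def power_mult_distrib)
    show "1 \<le> Re (p * q)"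
    proof (rule power2_le_imp_le)
      show "1\<^sup>2 \<le> (Re (p * q))\<^sup>2"
        using sq mult_mono[OF a b] a by simp
    qed (use pos in simp)
    show "1 < Re (p * q)" if "1 < Re a \<or> 1 < Re b"
    proof (rule power2_less_imp_less)
      have "1 < Re a * Re b"
        using that a b less_1_mult[of "Re a" "Re b"] by (cases "Re a = 1"; cases "Re b = 1") auto
      then show "1\<^sup>2 < (Re (p * q))\<^sup>2"
        using sq by simp
    qed (use pos in simp)
  qed
qed

text \<open>Two rounds of geometric means would give a fourth root of \<open>- 4\<close> with real part greater than 1,
  but these roots are \<open>\<plusminus> 1 \<plusminus> \<i>\<close>.\<close>
lemma four_factors_not_minus_four:
  fixes a b c d :: complex
  assumes "1 < Re a" "1 \<le> Re b" "1 \<le> Re c" "1 \<le> Re d"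
  shows "a * b * c * d \<noteq> - 4"
proof
  assume eq: "a * b * c * d = - 4"
  obtain e where e: "e\<^sup>2 = a * b" "1 \<le> Re e" "1 < Re e"
    using geometric_mean_Re[of a b] assms by auto
  obtain f where f: "f\<^sup>2 = c * d" "1 \<le> Re f"
    using geometric_mean_Re[of c d] assms by auto
  obtain g where g: "g\<^sup>2 = e * f" "1 < Re g"
    using geometric_mean_Re[of e f] e f by auto
  have "(g\<^sup>2)\<^sup>2 = - 4"
    using eq by (simp add: g e(1) f(1) power_mult_distrib mult.assoc)
  then have "(g\<^sup>2 - 2 * \<i>) * (g\<^sup>2 + 2 * \<i>) = 0"
    by (simp add: algebra_simps power2_eq_square)
  then have "g\<^sup>2 = 2 * \<i> \<or> g\<^sup>2 = - 2 * \<i>"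
    by (auto simp: eq_neg_iff_add_eq_0)
  then have "(Re g)\<^sup>2 = (Im g)\<^sup>2" "\<bar>Re g * Im g\<bar> = 1"
    by (auto simp: complex_eq_iff power2_eq_square mult.commute)
  then have "\<bar>Re g\<bar> * \<bar>Re g\<bar> = 1"
    by (metis abs_mult abs_power2 power2_eq_square power2_eq_iff abs_eq_iff)
  moreover have "1 < \<bar>Re g\<bar> * \<bar>Re g\<bar>"
    using g less_1_mult[of "Re g" "Re g"] by simp
  ultimately show False by simp
qed

lemma short_cycle:
  fixes f :: "'a::finite \<Rightarrow> 'a"
  assumes "CARD('a) \<le> 4" and f: "\<And>i. i \<in> S \<Longrightarrow> f i \<in> S" and "i \<in> S"
  obtains j m where "j \<in> S" "1 \<le> m" "m \<le> 4" "(f ^^ m) j = j"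
proof -
  have "\<not> inj_on (\<lambda>k. (f ^^ k) i) {0..4}"
    using card_inj_on_le[of "\<lambda>k. (f ^^ k) i" "{0..4::nat}" UNIV] assms(1) by auto
  then obtain k l where kl: "k < l" "l \<le> 4" "(f ^^ k) i = (f ^^ l) i"
    unfolding inj_on_def by (metis atLeastAtMost_iff linorder_neqE_nat)
  have S: "(f ^^ k) i \<in> S" for k
    by (induction k) (use assms f in auto)
  show thesis
  proof
    show "(f ^^ k) i \<in> S" by (rule S)
    show "(f ^^ (l - k)) ((f ^^ k) i) = (f ^^ k) i"
      using kl funpow_add[of "l - k" k f] by simp
  qed (use kl in auto)
qed

text \<open>This is the idea of Dmitriev and Dynkin, without convex polygons. Row \<open>i\<close> exhibits \<open>l * x i\<close> as a nonnegative
  combination of the differences \<open>x j - x i\<close>. If \<open>Re l + Im l > 0\<close>, then some \<open>j\<close> must have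
  \<open>Re ((1 - \<i>) * x j / x i) > 1\<close>. Passing from \<open>i\<close> to such a \<open>j\<close> repeatedly, one closes a cycle after \<open>m \<le> 4\<close>
  steps. Around the cycle the factors \<open>x j / x i\<close> multiply to 1, so the numbers \<open>(1 - \<i>) * x j / x i\<close>, together with
  \<open>4 - m\<close> copies of \<open>1 - \<i>\<close>, are four numbers of real part at least 1, not all of real part 1, with product \<open>(1 - \<i>) ^ 4 = - 4\<close>.\<close>
lemma left_eigenvalue_half_sector:
  fixes Q :: "'n::finite \<Rightarrow> 'n \<Rightarrow> real" and x :: "'n \<Rightarrow> complex"
  assumes card: "CARD('n) \<le> 4"
    and off: "\<And>i j. i \<noteq> j \<Longrightarrow> 0 \<le> Q i j" and row: "\<And>i. (\<Sum>j\<in>UNIV. Q i j) = 0"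
    and eig: "\<And>i. (\<Sum>j\<in>UNIV. Q i j * x j) = l * x i" and nz: "x i0 \<noteq> 0"
  shows "Re l + Im l \<le> 0"
proof (rule ccontr)
  assume l: "\<not> Re l + Im l \<le> 0"
  have "\<exists>j. 1 < Re ((1 - \<i>) * (x j / x i))" if xi: "x i \<noteq> 0" for i
  proof (rule ccontr)
    assume "\<nexists>j. 1 < Re ((1 - \<i>) * (x j / x i))"
    then have le: "Re ((1 - \<i>) * (x j / x i)) \<le> 1" for j
      by (meson not_le)
    have "(\<Sum>j\<in>UNIV. Q i j * (Re ((1 - \<i>) * (x j / x i)) - 1)) \<le> 0"
    proof (rule sum_nonpos)
      fix j
      show "Q i j * (Re ((1 - \<i>) * (x j / x i)) - 1) \<le> 0"
        using le[of j] off[of i j] xi by (cases "i = j") (auto simp: mult_nonneg_nonpos)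
    qed
    also have "(\<Sum>j\<in>UNIV. Q i j * (Re ((1 - \<i>) * (x j / x i)) - 1))
        = Re ((1 - \<i>) * ((\<Sum>j\<in>UNIV. Q i j * x j) / x i)) - (\<Sum>j\<in>UNIV. Q i j)"
    proof -
      have "(1 - \<i>) * ((\<Sum>j\<in>UNIV. Q i j * x j) / x i)
          = (\<Sum>j\<in>UNIV. Q i j * ((1 - \<i>) * (x j / x i)))"
        unfolding sum_divide_distrib sum_distrib_left by (intro sum.cong) simp_all
      moreover have "Re (complex_of_real q * z) = q * Re z" for q z
        by simp
      ultimately show ?thesis
        by (simp only: Re_sum sum_subtractf right_diff_distrib mult_1_right)
    qed
    also have "\<dots> = Re l + Im l"
      using xi by (simp add: eig row)
    finally show False
      using l by simp
  qed
  then obtain f where f: "\<And>i. x i \<noteq> 0 \<Longrightarrow> 1 < Re ((1 - \<i>) * (x (f i) / x i))"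
    by metis
  define w where "w i = (1 - \<i>) * (x (f i) / x i)" for i
  have w: "1 < Re (w i)" if "x i \<noteq> 0" for i
    using f that by (simp add: w_def)
  have fS: "x (f i) \<noteq> 0" if "x i \<noteq> 0" for i
    using f[OF that] by (cases "x (f i) = 0") auto
  obtain j m where jm: "x j \<noteq> 0" "1 \<le> m" "m \<le> 4" "(f ^^ m) j = j"
    using short_cycle[OF card, of "{i. x i \<noteq> 0}" f i0] fS nz by auto
  have four: "(1 - \<i>) * (1 - \<i>) * (1 - \<i>) * (1 - \<i>) = - 4"
    by (simp add: complex_eq_iff)
  note nz' = jm(1) fS[OF jm(1)] fS[OF fS[OF jm(1)]] fS[OF fS[OF fS[OF jm(1)]]]
  have "\<exists>a b c. 1 \<le> Re a \<and> 1 \<le> Re b \<and> 1 \<le> Re c \<and> w j * a * b * c = - 4"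
  proof -
    consider "m = 1" | "m = 2" | "m = 3" | "m = 4"
      using jm by linarith
    then show ?thesis
    proof cases
      case 1
      have "w j * (1 - \<i>) * (1 - \<i>) * (1 - \<i>) = - 4"
        using 1 jm nz' four by (simp add: w_def)
      then show ?thesis by (intro exI[of _ "1 - \<i>"]) simp
    next
      case 2
      have "w j * w (f j) * (1 - \<i>) * (1 - \<i>) = (1 - \<i>) * (1 - \<i>) * (1 - \<i>) * (1 - \<i>)"
        using 2 jm nz' by (simp add: w_def numeral_2_eq_2)
      then show ?thesis
        using w nz' four by (intro exI[of _ "w (f j)"] exI[of _ "1 - \<i>"]) (auto intro: less_imp_le)
    next
      case 3
      have "w j * w (f j) * w (f (f j)) * (1 - \<i>) = (1 - \<i>) * (1 - \<i>) * (1 - \<i>) * (1 - \<i>)"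
        using 3 jm nz' by (simp add: w_def numeral_3_eq_3)
      then show ?thesis
        using w nz' four by (intro exI[of _ "w (f j)"] exI[of _ "w (f (f j))"] exI[of _ "1 - \<i>"])
           (auto intro: less_imp_le)
    next
      case 4
      have "w j * w (f j) * w (f (f j)) * w (f (f (f j))) = (1 - \<i>) * (1 - \<i>) * (1 - \<i>) * (1 - \<i>)"
        using 4 jm nz' by (simp add: w_def eval_nat_numeral)
      then show ?thesis
        using w nz' four by (intro exI[of _ "w (f j)"] exI[of _ "w (f (f j))"] exI[of _ "w (f (f (f j)))"])
           (auto intro: less_imp_le)
    qed
  qed
  then show False
    using four_factors_not_minus_four w[OF jm(1)] by blast
qed

lemma eigenvector_transpose:
  fixes M :: "'a::field ^ 'n ^ 'n"
  assumes "M *v v = l *s v" "v \<noteq> 0"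
  obtains x where "x \<noteq> 0" "transpose M *v x = l *s x"
proof -
  define B where "B = M - mat l"
  have scal: "mat l *v x = l *s x" for x :: "'a ^ 'n"
    by (simp add: vec_eq_iff mat_def matrix_vector_mult_def if_distrib[of "\<lambda>a. a * _"] sum.delta' cong: if_cong)
  have "B *v v = 0"
    using assms by (simp add: B_def matrix_vector_mult_diff_rdistrib scal)
  then have "\<not> (\<exists>C. C ** B = mat 1)"
    using assms(2) matrix_left_invertible_ker by blast
  then have "\<not> (\<exists>C. C ** transpose B = mat 1)"
    by (metis left_invertible_transpose matrix_left_right_inverse)
  then obtain x where x: "transpose B *v x = 0" "x \<noteq> 0"
    using matrix_left_invertible_ker by blast
  have "transpose B = transpose M - mat l"
    by (simp add: B_def transpose_def mat_def vec_eq_iff)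
  then have "transpose M *v x = l *s x"
    using x by (simp add: matrix_vector_mult_diff_rdistrib scal)
  with x that show thesis by blast
qed

text \<open>The half-sector bound is applied to a left eigenvector and to its complex conjugate.\<close>
lemma conservative_eigenvalue_sector:
  fixes Z :: "real ^ 'n ^ 'n"
  assumes card: "CARD('n) \<le> 4" and Z: "conservative Z"
    and eig: "map_matrix complex_of_real Z *v v = l *s v" "v \<noteq> 0"
  shows "\<bar>Im l\<bar> \<le> - Re l"
proof -
  obtain x where x: "x \<noteq> 0" "transpose (map_matrix complex_of_real Z) *v x = l *s x"
    using eigenvector_transpose[OF eig] .
  then obtain i0 where i0: "x $ i0 \<noteq> 0"
    by (auto simp: vec_eq_iff)
  have eq: "(\<Sum>j\<in>UNIV. complex_of_real (Z $ j $ i) * x $ j) = l * x $ i" for i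
    using x(2) by (auto simp: vec_eq_iff matrix_vector_mult_def transpose_def map_matrix_def)
  have Q: "\<And>i j. i \<noteq> j \<Longrightarrow> 0 \<le> Z $ j $ i" "\<And>i. (\<Sum>j\<in>UNIV. Z $ j $ i) = 0"
    using Z by (auto simp: conservative_def)
  have "Re l + Im l \<le> 0"
    using left_eigenvalue_half_sector[of "\<lambda>i j. Z $ j $ i" "\<lambda>i. x $ i", OF card Q eq i0] .
  moreover have "Re (cnj l) + Im (cnj l) \<le> 0"
  proof (rule left_eigenvalue_half_sector[of "\<lambda>i j. Z $ j $ i" "\<lambda>i. cnj (x $ i)", OF card Q])
    show "(\<Sum>j\<in>UNIV. complex_of_real (Z $ j $ i) * cnj (x $ j)) = cnj l * cnj (x $ i)" for i
      using arg_cong[OF eq[of i], of cnj] by (simp add: cnj_sum)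
    show "cnj (x $ i0) \<noteq> 0" using i0 by simp
  qed
  ultimately show ?thesis by simp
qed

section \<open>The stability function\<close>

text \<open>The coefficients up to the third are forced by \<open>N(z) = D(z) exp z + O(z\<^sup>4)\<close>, the third order of the scheme;
  the last one comes from the stage equations (\<open>stage_num_equations\<close>).\<close>
definition stab_num :: "real \<Rightarrow> real \<Rightarrow> real poly" where
  "stab_num \<alpha> \<beta> = [:1, - (1 + \<alpha> + \<beta>), \<alpha> * \<beta> + \<alpha> + \<beta> - 1/2,
     (\<alpha> + \<beta>) / 2 - \<alpha> * \<beta> + 1/6, \<alpha> / 2 - \<alpha> * \<beta> - 1/6:]"

definition stab_den :: "real \<Rightarrow> real \<Rightarrow> real poly" where
  "stab_den \<alpha> \<beta> = [:1, - \<alpha>:] * [:1, - \<beta>:] * [:1, - 1:] ^ 2"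

lemma admissible_bounds:
  assumes "admissible \<alpha> \<beta>"
  shows "1/3 \<le> \<alpha>" "0 < \<beta>" "\<alpha> / 2 - 1/6 \<le> 2 * (\<alpha> * \<beta>)" "\<alpha> \<noteq> \<beta>" "\<alpha> \<noteq> 2/3"
proof -
  show ne: "\<alpha> \<noteq> \<beta>"
    using assms by (simp add: admissible_def)
  show a: "1/3 \<le> \<alpha>"
    using assms alpha0_root(2) by (auto simp: admissible_def)
  have "0 < \<beta> \<and> \<alpha> / 2 - 1/6 \<le> 2 * (\<alpha> * \<beta>) \<and> \<alpha> \<noteq> 2/3"
    using assms unfolding admissible_def
  proof (elim conjE disjE)
    assume h: "\<alpha> < 2/3" "2/3 \<le> \<beta>"
    then have "\<alpha> * (2/3) \<le> \<alpha> * \<beta>"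
      using a by (intro mult_left_mono) auto
    then have "\<alpha> / 2 - 1/6 \<le> 2 * (\<alpha> * \<beta>)"
      using a by linarith
    then show ?thesis
      using h by simp
  next
    assume h: "2/3 \<le> \<alpha>" "\<alpha> < alpha0" "3 * \<alpha> * (1 - \<alpha>) \<le> \<beta>" "\<beta> \<le> 2/3"
    have b: "3 * \<alpha> * (1 - \<alpha>) > 0"
      using h alpha0_root(3) by simp
    \<comment> \<open>The parabola \<open>3 \<alpha> (1 - \<alpha>)\<close> is bounded below by its chord over \<open>[2/3, 0.8926]\<close>, an interval containing \<open>[2/3, alpha0]\<close>.\<close>
    have "(\<alpha> - 2/3) * (4463/5000 - \<alpha>) \<ge> 0"
      using h alpha0_root(3) by (intro mult_nonneg_nonneg) auto
    moreover have "\<alpha> < 4463/5000"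
      using h alpha0_root(3) by simp
    moreover have "3 * \<alpha> * (1 - \<alpha>) = 3 * ((\<alpha> - 2/3) * (4463/5000 - \<alpha>)) + 4463/2500 - 8389/5000 * \<alpha>"
      by (simp add: field_simps)
    ultimately have q: "3 * \<alpha> * (1 - \<alpha>) \<ge> 1/4"
      by linarith
    have "\<alpha> * \<beta> \<ge> \<alpha> * (1/4)"
      using q h by (intro mult_left_mono) auto
    then have "\<alpha> / 2 - 1/6 \<le> 2 * (\<alpha> * \<beta>)"
      by linarith
    moreover have "\<alpha> \<noteq> 2/3"
    proof
      assume "\<alpha> = 2/3"
      with h ne show False by simp
    qed
    ultimately show ?thesis
      using h b by auto
  next
    assume h: "alpha0 < \<alpha>" "(3 * \<alpha> - 2) / (6 * \<alpha> - 3) \<le> \<beta>" "\<beta> \<le> 2/3"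
    have a89: "357/400 < \<alpha>"
      using h alpha0_root(2) by simp
    then have "0 < (3 * \<alpha> - 2) / (6 * \<alpha> - 3)"
      by simp
    then have b: "0 < \<beta>"
      using h by linarith
    have le: "3 * \<alpha> - 2 \<le> \<beta> * (6 * \<alpha> - 3)"
      using h(2) a89 by (simp add: pos_divide_le_eq)
    have "(\<alpha> / 2 - 1/6) * (6 * \<alpha> - 3) \<le> 2 * \<alpha> * (3 * \<alpha> - 2)"
    proof -
      have "357/400 * \<alpha> \<le> \<alpha> * \<alpha>"
        using a89 by (intro mult_right_mono) auto
      moreover have "2 * \<alpha> * (3 * \<alpha> - 2) - (\<alpha> / 2 - 1/6) * (6 * \<alpha> - 3) = 3 * (\<alpha> * \<alpha>) - 3/2 * \<alpha> - 1/2"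
        by (simp add: field_simps)
      ultimately show ?thesis
        using a89 by linarith
    qed
    also have "\<dots> \<le> 2 * \<alpha> * (\<beta> * (6 * \<alpha> - 3))"
      using le a89 by (intro mult_left_mono) auto
    finally have "(\<alpha> / 2 - 1/6) * (6 * \<alpha> - 3) \<le> (2 * (\<alpha> * \<beta>)) * (6 * \<alpha> - 3)"
      by (simp only: mult.assoc)
    then have "\<alpha> / 2 - 1/6 \<le> 2 * (\<alpha> * \<beta>)"
      using a89 by (subst (asm) mult_le_cancel_right) auto
    then show ?thesis
      using b a89 by auto
  qed
  then show "0 < \<beta>" "\<alpha> / 2 - 1/6 \<le> 2 * (\<alpha> * \<beta>)" "\<alpha> \<noteq> 2/3" by auto
qed

text \<open>With \<open>z = - r exp (\<i> \<theta>)\<close> the coefficient of \<open>r ^ m\<close> involves only \<open>cos ((j - k) \<theta>)\<close> for \<open>j + k = m\<close>; these cosines become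
  polynomials in \<open>x = r cos \<theta>\<close>, \<open>\<rho> = r\<^sup>2\<close> and \<open>\<tau> = r\<^sup>2 cos (2 \<theta>)\<close>. The sector in question is \<open>x \<ge> 0\<close>, \<open>\<tau> \<ge> 0\<close>.\<close>
lemma cmod_sq_quartic:
  fixes c1 c2 c3 c4 x y :: real and z :: complex
  assumes "\<rho> = x^2 + y^2" and "\<tau> = x^2 - y^2" and "z = - Complex x y"
  shows "(cmod (poly (map_poly of_real [:1, c1, c2, c3, c4:]) z))^2 =
    1 - 2 * c1 * x + (c1^2 * \<rho> + 2 * c2 * \<tau>) - 2 * x * (c1 * c2 * \<rho> + c3 * (2 * \<tau> - \<rho>))
    + (c2^2 * \<rho>^2 + 2 * c1 * c3 * \<tau> * \<rho> + 2 * c4 * (2 * \<tau>^2 - \<rho>^2))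
    - 2 * x * (c2 * c3 * \<rho>^2 + c1 * c4 * \<rho> * (2 * \<tau> - \<rho>)) + (c3^2 * \<rho>^3 + 2 * c2 * c4 * \<tau> * \<rho>^2)
    - 2 * x * c3 * c4 * \<rho>^3 + c4^2 * \<rho>^4"
  unfolding cmod_power2 assms
  by (simp add: map_poly_pCons power2_eq_square power3_eq_cube power4_eq_xxxx algebra_simps)

lemma stab_den_coeffs:
  "stab_den \<alpha> \<beta> = [:1, - (\<alpha> + \<beta> + 2), \<alpha> * \<beta> + 2 * (\<alpha> + \<beta>) + 1, - (\<alpha> + \<beta> + 2 * (\<alpha> * \<beta>)), \<alpha> * \<beta>:]"
  by (simp add: stab_den_def power2_eq_square algebra_simps)

text \<open>In the variables of \<open>cmod_sq_quartic\<close>, \<open>\<bar>D\<bar>\<^sup>2 - \<bar>N\<bar>\<^sup>2\<close> is a sum of terms that are nonnegative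
  for \<open>\<tau> \<ge> 0\<close>, and its term \<open>2 x\<close> of lowest order is positive. The third condition on the parameters says that
  the leading coefficient of \<open>N\<close> does not exceed that of \<open>D\<close>.\<close>
lemma stab_num_less_den:
  fixes z :: complex
  assumes a: "1/3 \<le> \<alpha>" and b: "0 < \<beta>" and ab: "\<alpha> / 2 - 1/6 \<le> 2 * (\<alpha> * \<beta>)"
    and z: "z \<noteq> 0" "\<bar>Im z\<bar> \<le> - Re z"
  shows "cmod (poly (map_poly of_real (stab_num \<alpha> \<beta>)) z) < cmod (poly (map_poly of_real (stab_den \<alpha> \<beta>)) z)"
proof -
  \<comment> \<open>All coefficients are expressed through the symmetric functions \<open>s = \<alpha> + \<beta>\<close>, \<open>p = \<alpha> \<beta>\<close> and the leading coefficient \<open>e\<close> of the numerator.\<close>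
  define x y where "x = - Re z" and "y = - Im z"
  have zxy: "z = - Complex x y"
    by (simp add: x_def y_def complex_eq_iff)
  have x: "0 < x" "\<bar>y\<bar> \<le> x"
    using z by (auto simp: x_def y_def complex_eq_iff)
  define \<rho> \<tau> where "\<rho> = x^2 + y^2" and "\<tau> = x^2 - y^2"
  have \<tau>0: "0 \<le> \<tau>"
    using x abs_le_square_iff[of y x] by (simp add: \<tau>_def)
  have \<tau>\<rho>: "\<tau> \<le> \<rho>"
    by (simp add: \<tau>_def \<rho>_def)
  then have \<rho>0: "0 \<le> \<rho>"
    using \<tau>0 by simp
  define s p e where "s = \<alpha> + \<beta>" and "p = \<alpha> * \<beta>" and "e = \<alpha> / 2 - \<alpha> * \<beta> - 1/6"
  have s: "1/3 \<le> s" and \<alpha>s: "\<alpha> \<le> s"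
    using a b by (auto simp: s_def)
  have p: "0 < p"
    using a b by (simp add: p_def)
  have e: "e \<le> p" "-p \<le> e"
    using ab a by (auto simp: e_def p_def)
  have sp: "4 * p \<le> s^2"
    using zero_le_power2[of "\<alpha> - \<beta>"] by (simp add: s_def p_def power2_eq_square algebra_simps)
  define u2 u3 v2 v3 where "u2 = p + s - 1/2" and "u3 = s / 2 - p + 1/6"
    and "v2 = p + 2 * s + 1" and "v3 = s + 2 * p"
  have N: "stab_num \<alpha> \<beta> = [:1, -(1+s), u2, u3, e:]"
    by (simp add: stab_num_def s_def p_def e_def u2_def u3_def)
  have D: "stab_den \<alpha> \<beta> = [:1, -(s+2), v2, -v3, p:]"
    by (simp add: stab_den_coeffs s_def p_def v2_def v3_def)
  define C4 where "C4 = v2^2 - u2^2 + 2 * (e - p)"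
  define C5 where "C5 = (u2 * u3 + v2 * v3) + ((1+s) * e - (s+2) * p)"
  have diff: "cmod (poly (map_poly of_real (stab_den \<alpha> \<beta>)) z) ^ 2 - cmod (poly (map_poly of_real (stab_num \<alpha> \<beta>)) z) ^ 2
    = 2 * x + (2 * s+3) * (\<rho> + \<tau>) + 2 * x * ((s^2+3 * s+7/3) * \<rho> + 2 * (u3+v3) * \<tau>)
     + C4 * \<rho>^2 + 2 * ((s+2) * v3 + (1+s) * u3) * \<tau> * \<rho> + 4 * (p-e) * \<tau>^2
     + 2 * x * (C5 * \<rho>^2 + 2 * ((s+2) * p - (1+s) * e) * \<tau> * \<rho>)
     + (v3^2 - u3^2) * \<rho>^3 + 2 * (v2 * p - u2 * e) * \<tau> * \<rho>^2
     + 2 * x * (v3 * p + u3 * e) * \<rho>^3 + (p^2 - e^2) * \<rho>^4"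
    unfolding N D cmod_sq_quartic[OF \<rho>_def \<tau>_def zxy] C4_def C5_def u2_def u3_def v2_def v3_def
    by (simp add: power2_eq_square power3_eq_cube power4_eq_xxxx field_simps)
  have C4: "0 \<le> C4"
  proof -
    have "C4 = 2 * p * s + 3 * s^2 + 5 * s - p + \<alpha> + 5/12"
      unfolding C4_def u2_def v2_def e_def p_def by (simp add: power2_eq_square algebra_simps)
    moreover have "0 < p * s"
      using s p by simp
    ultimately show ?thesis
      using sp s p a by linarith
  qed
  have C5: "0 \<le> C5"
  proof -
    have "C5 = p^2 + 5/2 * s * p - p/3 + 5/2 * s^2+3/4 * s-1/4+(1+s) * \<alpha>/2"
      unfolding C5_def u2_def u3_def v2_def v3_def e_def p_def by (simp add: power2_eq_square field_simps)
    moreover have "s * s \<ge> 1/3 * (1/3)"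
      using s by (intro mult_mono) auto
    moreover have "0 \<le> p^2 + 5/2 * s * p + (1+s) * \<alpha>/2"
      using s p a by (intro add_nonneg_nonneg) auto
    ultimately show ?thesis
      using sp s by (simp add: power2_eq_square)
  qed
  have pe: "(1+s) * e \<le> (s+2) * p"
    using mult_left_mono[OF e(1), of "1+s"] s p by (simp add: algebra_simps)
  have uv3: "u3^2 \<le> v3^2"
    unfolding abs_le_square_iff[symmetric] using s p by (simp add: u3_def v3_def abs_if)
  have u2e: "u2 * e \<le> v2 * p"
  proof -
    have "u2 * e \<le> \<bar>u2\<bar> * \<bar>e\<bar>"
      by (metis abs_ge_self abs_mult)
    also have "\<dots> \<le> v2 * p"
      using e s p by (intro mult_mono) (auto simp: u2_def v2_def)
    finally show ?thesis .
  qed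
  have v3p: "0 \<le> v3 * p + u3 * e"
  proof -
    have "v3 * p + u3 * e = 3 * p^2 + p * (s - \<alpha>) / 2 + (\<alpha>/4 - 1/12) * s + (\<alpha>/12 - 1/36)"
      unfolding v3_def u3_def e_def p_def by (simp add: power2_eq_square field_simps)
    then show ?thesis
      using p \<alpha>s a s by simp
  qed
  have ep2: "e^2 \<le> p^2"
    using e p by (intro abs_le_square_iff[THEN iffD1]) auto
  have E: "0 \<le> u3 + v3" and G: "0 \<le> (s+2) * v3 + (1+s) * u3"
    using s p mult_pos_pos[of s p] by (auto simp: u3_def v3_def power2_eq_square algebra_simps)
  have "0 \<le> (2 * s + 3) * (\<rho> + \<tau>)"
    using s \<rho>0 \<tau>0 by simp
  moreover have "0 \<le> 2 * x * ((s^2 + 3 * s + 7/3) * \<rho> + 2 * (u3 + v3) * \<tau>)"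
    by (intro E mult_nonneg_nonneg[OF _ \<tau>0] mult_nonneg_nonneg add_nonneg_nonneg) (use x(1) s \<rho>0 in auto)
  moreover have "0 \<le> C4 * \<rho>^2"
    using C4 by simp
  moreover have "0 \<le> 2 * ((s + 2) * v3 + (1 + s) * u3) * \<tau> * \<rho>"
    using G \<rho>0 \<tau>0 by (intro mult_nonneg_nonneg) auto
  moreover have "0 \<le> 4 * (p - e) * \<tau>^2"
    using e by simp
  moreover have "0 \<le> 2 * x * (C5 * \<rho>^2 + 2 * ((s + 2) * p - (1 + s) * e) * \<tau> * \<rho>)"
    using x(1) C5 pe \<rho>0 \<tau>0 by (intro mult_nonneg_nonneg add_nonneg_nonneg) auto
  moreover have "0 \<le> (v3^2 - u3^2) * \<rho>^3"
    using uv3 \<rho>0 by simp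
  moreover have "0 \<le> 2 * (v2 * p - u2 * e) * \<tau> * \<rho>^2"
    using u2e \<tau>0 by (intro mult_nonneg_nonneg) auto
  moreover have "0 \<le> 2 * x * (v3 * p + u3 * e) * \<rho>^3"
    using x(1) v3p \<rho>0 by (intro mult_nonneg_nonneg) auto
  moreover have "0 \<le> (p^2 - e^2) * \<rho>^4"
    using ep2 by simp
  ultimately have "cmod (poly (map_poly of_real (stab_num \<alpha> \<beta>)) z) ^ 2 < cmod (poly (map_poly of_real (stab_den \<alpha> \<beta>)) z) ^ 2"
    using diff x(1) by linarith
  then show ?thesis
    by (rule power_less_imp_less_base) simp
qed

section \<open>Polynomials in a matrix and linear recurrences\<close>

text \<open>The vector \<open>p(M) v\<close>, by Horner's rule, so that the matrices of type \<open>'a ^ 'n ^ 'n\<close> need no ring structure.\<close>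
definition op_poly :: "'a::field ^ 'n ^ 'n \<Rightarrow> 'a poly \<Rightarrow> 'a ^ 'n \<Rightarrow> 'a ^ 'n" where
  "op_poly M p = fold_coeffs (\<lambda>a f v. a *s v + M *v f v) p (\<lambda>_. 0)"

lemma op_poly_0 [simp]: "op_poly M 0 v = 0"
  by (simp add: op_poly_def)

lemma op_poly_pCons [simp]: "op_poly M (pCons a p) v = a *s v + M *v op_poly M p v"
  by (cases "p = 0 \<and> a = 0") (auto simp: op_poly_def)

lemma op_poly_add_right: "op_poly M p (v + w) = op_poly M p v + op_poly M p w"
  by (induction p) (simp_all add: vec.add vec.scale_right_distrib algebra_simps)

lemma op_poly_scale_right: "op_poly M p (c *s v) = c *s op_poly M p v"
  by (induction p) (simp_all add: vec.scale vec.scale_right_distrib mult.commute)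

lemma op_poly_mult_right: "op_poly M p (M *v v) = M *v op_poly M p v"
  by (induction p) (simp_all add: vec.add vec.scale)

lemma op_poly_add: "op_poly M (p + q) v = op_poly M p v + op_poly M q v"
  by (induction p q rule: poly_induct2) (simp_all add: vec.add vec.scale_left_distrib algebra_simps)

lemma op_poly_smult: "op_poly M (smult c p) v = c *s op_poly M p v"
  by (induction p) (simp_all add: vec.scale vec.scale_right_distrib)

lemma op_poly_diff: "op_poly M (p - q) v = op_poly M p v - op_poly M q v"
proof -
  have "op_poly M (p - q) v = op_poly M (p + smult (- 1) q) v" by simp
  also have "\<dots> = op_poly M p v - op_poly M q v"
    unfolding op_poly_add op_poly_smult by simp
  finally show ?thesis .
qed

lemma op_poly_mult: "op_poly M (p * q) v = op_poly M p (op_poly M q v)"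
  by (induction p) (simp_all add: op_poly_add op_poly_smult)

lemma op_poly_sum: "finite I \<Longrightarrow> op_poly M (\<Sum>i\<in>I. p i) v = (\<Sum>i\<in>I. op_poly M (p i) v)"
  by (induction I rule: finite_induct) (simp_all add: op_poly_add)

lemma op_poly_sum_right: "finite I \<Longrightarrow> op_poly M p (\<Sum>i\<in>I. v i) = (\<Sum>i\<in>I. op_poly M p (v i))"
proof (induction I rule: finite_induct)
  case empty
  show ?case using op_poly_scale_right[of M p 0 0] by simp
qed (simp add: op_poly_add_right)

text \<open>The \<open>n + 1\<close> vectors \<open>v, M v, \<dots>, M\<^sup>n v\<close> are linearly dependent, or two of them coincide.\<close>
lemma annihilating_poly_vector:
  fixes M :: "'a::field ^ 'n ^ 'n"
  shows "\<exists>p. p \<noteq> 0 \<and> op_poly M p v = 0"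
proof -
  define f where "f k = op_poly M (monom 1 k) v" for k
  show ?thesis
  proof (cases "inj_on f {..CARD('n)}")
    case True
    have "vec.dependent (f ` {..CARD('n)})"
    proof (rule ccontr)
      assume "\<not> vec.dependent (f ` {..CARD('n)})"
      then have "card (f ` {..CARD('n)}) \<le> vec.dim (UNIV :: ('a ^ 'n) set)"
        by (intro vec.independent_card_le_dim) auto
      then show False
        using card_image[OF True] by (simp add: vec.dim_UNIV card_cart_basis)
    qed
    then obtain u y where u: "(\<Sum>x\<in>f ` {..CARD('n)}. u x *s x) = 0"
        "y \<in> f ` {..CARD('n)}" "u y \<noteq> 0"
      by (auto simp: vec.dependent_finite)
    from u(2) obtain k where k: "k \<le> CARD('n)" "y = f k" by auto
    define p where "p = (\<Sum>j\<in>{..CARD('n)}. smult (u (f j)) (monom 1 j))"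
    have "op_poly M p v = 0"
      using u(1) by (simp add: p_def op_poly_sum op_poly_smult f_def sum.reindex[OF True, unfolded f_def] del: smult_monom)
    moreover have "coeff p k = u (f k)"
      using k by (simp add: p_def coeff_sum smult_monom if_distrib sum.delta cong: if_cong)
    then have "p \<noteq> 0"
      using u k by auto
    ultimately show ?thesis by blast
  next
    case False
    then obtain j k where jk: "j \<noteq> k" "f j = f k"
      by (auto simp: inj_on_def)
    have "op_poly M (monom 1 j + smult (- 1) (monom 1 k)) v = 0"
      using jk(2) unfolding op_poly_add op_poly_smult f_def by simp
    moreover have "coeff (monom 1 j + smult (- 1) (monom 1 k)) j \<noteq> (0::'a)"
      using jk by simp
    ultimately show ?thesis
      by (metis coeff_0)
  qed
qed

lemma annihilating_poly:
  fixes M :: "'a::field ^ 'n ^ 'n"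
  obtains p where "p \<noteq> 0" "\<And>v. op_poly M p v = 0"
proof -
  obtain q where q: "\<And>i. q i \<noteq> 0" "\<And>i. op_poly M (q i) (axis i 1) = 0"
    using annihilating_poly_vector[of M "axis _ 1"] by metis
  define p where "p = (\<Prod>i\<in>UNIV. q i)"
  have ax: "op_poly M p (axis i 1) = 0" for i
  proof -
    have "p = (\<Prod>j\<in>UNIV - {i}. q j) * q i"
      unfolding p_def by (subst prod.remove[of _ i]) (auto simp: mult.commute)
    then show ?thesis
      using op_poly_scale_right[of M _ 0 0] by (simp add: op_poly_mult q)
  qed
  show thesis
  proof
    show "p \<noteq> 0" using q by (simp add: p_def)
    fix v :: "'a ^ 'n"
    have "op_poly M p (\<Sum>i\<in>UNIV. v $ i *s axis i 1) = 0"
      by (simp add: op_poly_sum_right op_poly_scale_right ax)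
    then show "op_poly M p v = 0"
      by (simp add: basis_expansion)
  qed
qed

lemma contraction_recurrence_tendsto_0:
  fixes a e :: "nat \<Rightarrow> real"
  assumes \<rho>: "0 \<le> \<rho>" "\<rho> < 1" and a: "\<And>n. 0 \<le> a n" "\<And>n. a (Suc n) \<le> \<rho> * a n + e n"
    and e: "e \<longlonglongrightarrow> 0"
  shows "a \<longlonglongrightarrow> 0"
proof (rule LIMSEQ_I)
  fix r :: real assume r: "0 < r"
  define d where "d = r / 2"
  have d: "0 < d" using r by (simp add: d_def)
  then have "\<forall>\<^sub>F n in sequentially. e n < d * (1 - \<rho>)"
    using \<rho> e by (intro order_tendstoD) auto
  then obtain K where K: "\<And>n. K \<le> n \<Longrightarrow> e n < d * (1 - \<rho>)"
    by (auto simp: eventually_sequentially)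
  have bound: "a (K + m) \<le> \<rho> ^ m * a K + d" for m
  proof (induction m)
    case 0
    show ?case using d by simp
  next
    case (Suc m)
    have "a (K + Suc m) \<le> \<rho> * a (K + m) + e (K + m)"
      using a(2) by simp
    also have "\<dots> \<le> \<rho> * (\<rho> ^ m * a K + d) + d * (1 - \<rho>)"
      using Suc \<rho> K[of "K + m"] by (intro add_mono mult_left_mono) auto
    finally show ?case by (simp add: algebra_simps)
  qed
  have "(\<lambda>m. \<rho> ^ m * a K) \<longlonglongrightarrow> 0"
    using \<rho> by (intro tendsto_mult_left_zero LIMSEQ_realpow_zero) auto
  then have "\<forall>\<^sub>F m in sequentially. \<rho> ^ m * a K < d"
    using d by (intro order_tendstoD) auto
  then obtain L where L: "\<And>m. L \<le> m \<Longrightarrow> \<rho> ^ m * a K < d"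
    by (auto simp: eventually_sequentially)
  show "\<exists>no. \<forall>n\<ge>no. norm (a n - 0) < r"
  proof (intro exI allI impI)
    fix n assume "K + L \<le> n"
    then obtain m where "n = K + m" "L \<le> m"
      by (metis add_leD1 le_Suc_ex nat_add_left_cancel_le)
    then show "norm (a n - 0) < r"
      using bound[of m] L[of m] a(1)[of n] by (simp add: d_def)
  qed
qed

lemma op_poly_tendsto_0:
  fixes M :: "complex ^ 'n ^ 'n"
  assumes "h \<longlonglongrightarrow> 0"
  shows "(\<lambda>n. op_poly M p (h n)) \<longlonglongrightarrow> 0"
proof (induction p)
  case (pCons a p)
  have mv: "(\<lambda>n. M *v g n) \<longlonglongrightarrow> 0" if g: "g \<longlonglongrightarrow> 0" for g
  proof (rule vec_tendstoI)
    fix i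
    have "(\<lambda>n. \<Sum>j\<in>UNIV. M $ i $ j * g n $ j) \<longlonglongrightarrow> (\<Sum>j\<in>UNIV. M $ i $ j * 0 $ j)"
      by (intro tendsto_intros tendsto_vec_nth g)
    then show "(\<lambda>n. (M *v g n) $ i) \<longlonglongrightarrow> 0 $ i"
      by (simp add: matrix_vector_mult_def)
  qed
  have "(\<lambda>n. a *s h n) \<longlonglongrightarrow> 0"
  proof (rule vec_tendstoI)
    fix i
    have "(\<lambda>n. a * h n $ i) \<longlonglongrightarrow> a * 0 $ i"
      by (intro tendsto_intros tendsto_vec_nth assms)
    then show "(\<lambda>n. (a *s h n) $ i) \<longlonglongrightarrow> 0 $ i" by simp
  qed
  from tendsto_add[OF this mv[OF pCons.IH]] show ?case by simp
qed simp

text \<open>Convergence to 0 of \<open>h n = (N(M) D(M)\<^sup>-\<^sup>1)\<^sup>n h 0\<close> from a bound on the spectrum of \<open>M\<close>, without a Jordan normal form. Let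
  \<open>p\<close> be a polynomial with \<open>p(M) h n = 0\<close>, and \<open>l\<close> a root of \<open>p\<close>. The sequence \<open>(M - l) h n\<close> solves the same recurrence and is killed
  by a polynomial of smaller degree, so it tends to 0. Modulo this sequence the recurrence reads
  \<open>D(l) h (n + 1) = N(l) h n\<close>, which is a contraction if \<open>l\<close> is a nonzero eigenvalue. Otherwise \<open>M - l\<close> is injective
  on the range of \<open>M\<close>, and the factor \<open>X - l\<close> can be dropped from \<open>p\<close>.\<close>
lemma rational_recurrence_tendsto_0:
  fixes M :: "complex ^ 'n ^ 'n" and N D :: "complex poly"
  assumes spec: "\<And>l v. v \<noteq> 0 \<Longrightarrow> M *v v = l *s v \<Longrightarrow> l \<noteq> 0 \<Longrightarrow> cmod (poly N l) < cmod (poly D l)"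
    and semisimple: "\<And>u. M *v (M *v u) = 0 \<Longrightarrow> M *v u = 0"
    and rec: "\<And>n. op_poly M D (h (Suc n)) = op_poly M N (h n)"
    and range: "\<And>n. h n \<in> range ((*v) M)"
  shows "h \<longlonglongrightarrow> 0"
proof -
  have "h \<longlonglongrightarrow> 0" if "p \<noteq> 0" "\<And>n. op_poly M p (h n) = 0"
      "\<And>n. op_poly M D (h (Suc n)) = op_poly M N (h n)" "\<And>n. h n \<in> range ((*v) M)" for p h
    using that
  proof (induction "degree p" arbitrary: p h)
    case 0
    then obtain c where "p = [:c:]" "c \<noteq> 0"
      by (metis degree_eq_zeroE pCons_eq_0_iff)
    then have "h n = 0" for n
      using 0(3)[of n] by simp
    then show ?case by simp
  next
    case (Suc d)
    have "\<not> constant (poly p)"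
      using Suc(2) constant_degree[of p] by simp
    then obtain l where "poly p l = 0"
      using fundamental_theorem_of_algebra by blast
    then obtain q where q: "p = [:- l, 1:] * q"
      by (auto simp: poly_eq_0_iff_dvd)
    with Suc(3) have q0: "q \<noteq> 0" by auto
    with Suc(2) have deg: "d = degree q"
      by (subst (asm) q, subst (asm) degree_mult_eq) auto
    have X: "op_poly M [:- l, 1:] v = M *v v - l *s v" for v
      by (simp add: vec.scale_minus_left)
    show ?case
    proof (cases "l \<noteq> 0 \<and> (\<exists>v. v \<noteq> 0 \<and> M *v v = l *s v)")
      case True
      define h' where "h' n = op_poly M [:- l, 1:] (h n)" for n
      have h': "h' \<longlonglongrightarrow> 0"
      proof (rule Suc(1)[OF deg q0])
        fix n
        show "op_poly M q (h' n) = 0"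
          using Suc(4)[of n] unfolding q h'_def by (simp only: op_poly_mult[symmetric] mult.commute)
        show "op_poly M D (h' (Suc n)) = op_poly M N (h' n)"
          unfolding h'_def by (metis Suc(5) op_poly_mult mult.commute)
        show "h' n \<in> range ((*v) M)"
          using Suc(6)[of n] unfolding h'_def by (auto simp only: op_poly_mult_right)
      qed
      \<comment> \<open>Division by \<open>X - l\<close> expresses \<open>D(M) v\<close> as \<open>D(l) v\<close> plus a term that depends only on \<open>(M - l) v\<close>; likewise for \<open>N\<close>.\<close>
      define sd where "sd = synthetic_div D l"
      define sn where "sn = synthetic_div N l"
      define e where "e n = op_poly M sn (h' n) + (- 1) *s op_poly M sd (h' (Suc n))" for n
      have split: "op_poly M P v = op_poly M (synthetic_div P l) (op_poly M [:- l, 1:] v) + poly P l *s v" for P v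
      proof -
        have "P = synthetic_div P l * [:- l, 1:] + [:poly P l:]"
          using synthetic_div_correct'[of l P] by (simp only: mult.commute)
        then have "op_poly M P v = op_poly M (synthetic_div P l * [:- l, 1:] + [:poly P l:]) v"
          by simp
        also have "\<dots> = op_poly M (synthetic_div P l) (op_poly M [:- l, 1:] v) + op_poly M [:poly P l:] v"
          by (simp only: op_poly_add op_poly_mult)
        finally show ?thesis by simp
      qed
      have step: "poly D l * h (Suc n) $ i = poly N l * h n $ i + e n $ i" for n i
        using arg_cong[OF Suc(5)[of n], of "\<lambda>v. v $ i"]
        unfolding split[of D] split[of N] e_def h'_def sd_def sn_def by (simp add: algebra_simps)
      have e0: "e \<longlonglongrightarrow> 0"
      proof -
        have "(\<lambda>n. h' (Suc n)) \<longlonglongrightarrow> 0"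
          using h' by (simp add: LIMSEQ_Suc)
        then have "(\<lambda>n. op_poly M (smult (- 1) sd) (h' (Suc n))) \<longlonglongrightarrow> 0"
          by (rule op_poly_tendsto_0)
        from tendsto_add[OF op_poly_tendsto_0[OF h'] this] show ?thesis
          unfolding e_def op_poly_smult by simp
      qed
      have lt: "cmod (poly N l) < cmod (poly D l)"
        using True spec by blast
      show ?thesis
      proof (rule vec_tendstoI)
        fix i
        have "(\<lambda>n. cmod (h n $ i)) \<longlonglongrightarrow> 0"
        proof (rule contraction_recurrence_tendsto_0)
          show "0 \<le> cmod (poly N l) / cmod (poly D l)" "cmod (poly N l) / cmod (poly D l) < 1"
            using lt by (auto simp: divide_less_eq_1)
          show "cmod (h (Suc n) $ i) \<le> cmod (poly N l) / cmod (poly D l) * cmod (h n $ i)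
              + cmod (e n $ i) / cmod (poly D l)" for n
          proof -
            have "cmod (poly D l) * cmod (h (Suc n) $ i) \<le> cmod (poly N l) * cmod (h n $ i) + cmod (e n $ i)"
              by (metis step norm_mult norm_triangle_ineq)
            moreover have "0 < cmod (poly D l)"
              using lt norm_ge_zero[of "poly N l"] by linarith
            ultimately show ?thesis
              by (simp add: field_simps)
          qed
          show "(\<lambda>n. cmod (e n $ i) / cmod (poly D l)) \<longlonglongrightarrow> 0"
            using tendsto_vec_nth[OF e0, of i]
            by (intro tendsto_divide_zero tendsto_norm_zero) simp
        qed simp
        then show "(\<lambda>n. h n $ i) \<longlonglongrightarrow> 0 $ i"
          by (simp add: tendsto_norm_zero_iff)
      qed
    next
      case False
      have "op_poly M q (h n) = 0" for n
      proof (rule ccontr)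
        let ?u = "op_poly M q (h n)"
        assume u: "?u \<noteq> 0"
        have "op_poly M [:- l, 1:] ?u = 0"
          using Suc(4)[of n] unfolding q op_poly_mult .
        then have eig: "M *v ?u = l *s ?u"
          unfolding X by simp
        with False u have "l = 0" by blast
        with eig have "M *v ?u = 0" by simp
        moreover obtain w where "h n = M *v w"
          using Suc(6) by blast
        then have "?u = M *v op_poly M q w"
          by (simp add: op_poly_mult_right)
        ultimately show False
          using semisimple u by metis
      qed
      then show ?thesis
        using Suc(1)[OF deg q0] Suc(5,6) by blast
    qed
  qed
  then show ?thesis
    using annihilating_poly[of M] rec range by metis
qed

definition of_real_vec :: "real ^ 'n \<Rightarrow> complex ^ 'n" where
  "of_real_vec v = (\<chi> i. of_real (v $ i))"

lemma map_matrix_of_real_vec: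
  "map_matrix complex_of_real Z *v of_real_vec v = of_real_vec (Z *v v)"
  by (simp add: vec_eq_iff of_real_vec_def matrix_vector_mult_def map_matrix_def)

lemma op_poly_of_real_vec:
  "op_poly (map_matrix complex_of_real Z) (map_poly of_real p) (of_real_vec v) = of_real_vec (op_poly Z p v)"
proof (induction p)
  case (pCons a p)
  then show ?case
    by (simp add: map_poly_pCons map_matrix_of_real_vec) (simp add: of_real_vec_def vec_eq_iff)
qed (simp add: of_real_vec_def vec_eq_iff)

lemma conservative_complex_semisimple:
  assumes Z: "conservative Z"
    and u: "map_matrix complex_of_real Z *v (map_matrix complex_of_real Z *v u) = 0"
  shows "map_matrix complex_of_real Z *v u = 0"
proof -
  define re im where "re w = (\<chi> i. Re (w $ i))" and "im w = (\<chi> i. Im (w $ i))" for w :: "complex ^ 'a"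
  have re: "re (map_matrix complex_of_real Z *v w) = Z *v re w" for w
    by (simp add: re_def vec_eq_iff matrix_vector_mult_def map_matrix_def)
  have im: "im (map_matrix complex_of_real Z *v w) = Z *v im w" for w
    by (simp add: im_def vec_eq_iff matrix_vector_mult_def map_matrix_def)
  have "Z *v (Z *v re u) = 0" "Z *v (Z *v im u) = 0"
    unfolding re[symmetric] im[symmetric] u by (simp_all add: re_def im_def vec_eq_iff)
  then have "Z *v re u = 0" "Z *v im u = 0"
    using conservative_ker_range[OF Z refl] by blast+
  then show ?thesis
    unfolding re[symmetric] im[symmetric] by (simp add: re_def im_def vec_eq_iff complex_eq_iff)
qed

lemma stability_recurrence_tendsto_0:
  fixes Z :: "real ^ 'n ^ 'n"
  assumes card: "CARD('n) \<le> 4" and Z: "conservative Z"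
    and ab: "1/3 \<le> \<alpha>" "0 < \<beta>" "\<alpha> / 2 - 1/6 \<le> 2 * (\<alpha> * \<beta>)"
    and rec: "\<And>n. op_poly Z (stab_den \<alpha> \<beta>) (h (Suc n)) = op_poly Z (stab_num \<alpha> \<beta>) (h n)"
    and range: "\<And>n. h n \<in> range ((*v) Z)"
  shows "h \<longlonglongrightarrow> 0"
proof -
  have "(\<lambda>n. of_real_vec (h n)) \<longlonglongrightarrow> 0"
  proof (rule rational_recurrence_tendsto_0)
    show "cmod (poly (map_poly of_real (stab_num \<alpha> \<beta>)) l) < cmod (poly (map_poly of_real (stab_den \<alpha> \<beta>)) l)"
      if "v \<noteq> 0" "map_matrix complex_of_real Z *v v = l *s v" "l \<noteq> 0" for l v
      using that conservative_eigenvalue_sector[OF card Z] by (intro stab_num_less_den[OF ab]) auto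
    show "op_poly (map_matrix complex_of_real Z) (map_poly of_real (stab_den \<alpha> \<beta>)) (of_real_vec (h (Suc n)))
      = op_poly (map_matrix complex_of_real Z) (map_poly of_real (stab_num \<alpha> \<beta>)) (of_real_vec (h n))" for n
      by (simp add: op_poly_of_real_vec rec)
    show "of_real_vec (h n) \<in> range ((*v) (map_matrix complex_of_real Z))" for n
      using range[of n] by (auto simp flip: map_matrix_of_real_vec)
  qed (rule conservative_complex_semisimple[OF Z])
  then have "(\<lambda>n. Re (of_real_vec (h n) $ i)) \<longlonglongrightarrow> Re (0 $ i)" for i
    by (intro tendsto_intros tendsto_vec_nth)
  then show ?thesis
    by (intro vec_tendstoI) (simp add: of_real_vec_def)
qed

section \<open>Patankar stages near an equilibrium\<close>

text \<open>Landau symbols for vectors are read componentwise, since the Patankar weights act on components.\<close>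
definition small_vec :: "'b filter \<Rightarrow> ('b \<Rightarrow> real) \<Rightarrow> ('b \<Rightarrow> real ^ 'n) \<Rightarrow> bool" where
  "small_vec F n f \<longleftrightarrow> (\<forall>i. (\<lambda>x. f x $ i) \<in> o[F](n))"

definition big_vec :: "'b filter \<Rightarrow> ('b \<Rightarrow> real) \<Rightarrow> ('b \<Rightarrow> real ^ 'n) \<Rightarrow> bool" where
  "big_vec F n f \<longleftrightarrow> (\<forall>i. (\<lambda>x. f x $ i) \<in> O[F](n))"

lemma small_vec_imp_big_vec: "small_vec F n f \<Longrightarrow> big_vec F n f"
  by (auto simp: small_vec_def big_vec_def landau_o.small_imp_big)

lemma small_vec_add: "small_vec F n f \<Longrightarrow> small_vec F n g \<Longrightarrow> small_vec F n (\<lambda>x. f x + g x)"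
  and small_vec_diff: "small_vec F n f \<Longrightarrow> small_vec F n g \<Longrightarrow> small_vec F n (\<lambda>x. f x - g x)"
  by (auto simp: small_vec_def sum_in_smallo)

lemma big_vec_add: "big_vec F n f \<Longrightarrow> big_vec F n g \<Longrightarrow> big_vec F n (\<lambda>x. f x + g x)"
  and big_vec_diff: "big_vec F n f \<Longrightarrow> big_vec F n g \<Longrightarrow> big_vec F n (\<lambda>x. f x - g x)"
  by (auto simp: big_vec_def sum_in_bigo)

lemma small_vec_matrix_mult: "small_vec F n f \<Longrightarrow> small_vec F n (\<lambda>x. M *v f x)"
  by (auto simp: small_vec_def matrix_vector_mult_def intro!: big_sum_in_smallo)

lemma big_vec_matrix_mult: "big_vec F n f \<Longrightarrow> big_vec F n (\<lambda>x. M *v f x)"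
  by (auto simp: big_vec_def matrix_vector_mult_def intro!: big_sum_in_bigo)

lemma big_vec_scale: "big_vec F n f \<Longrightarrow> big_vec F n (\<lambda>x. c *s f x)"
  by (auto simp: big_vec_def)

lemma big_vec_op_poly: "big_vec F n f \<Longrightarrow> big_vec F n (\<lambda>x. op_poly M p (f x))"
proof (induction p)
  case 0
  show ?case by (simp add: big_vec_def)
next
  case (pCons a p)
  then show ?case
    by (auto intro!: big_vec_add big_vec_scale big_vec_matrix_mult)
qed

lemma small_cmult: "f \<in> o[F](g) \<Longrightarrow> (\<lambda>x. c * f x) \<in> o[F](g)" for c :: real
  by (cases "c = 0") simp_all

lemma small_vec_mult:
  assumes "\<And>i. ((\<lambda>x. w x $ i) \<longlongrightarrow> 0) F" "big_vec F n f"
  shows "small_vec F n (\<lambda>x. w x * f x)"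
  unfolding small_vec_def
proof
  fix i
  have "(\<lambda>x. w x $ i) \<in> o[F](\<lambda>_. 1)"
    using assms(1) by (intro smalloI_tendsto) auto
  then show "(\<lambda>x. (w x * f x) $ i) \<in> o[F](n)"
    using assms(2) landau_o.small_big_mult[of "\<lambda>x. w x $ i" F "\<lambda>_. 1" "\<lambda>x. f x $ i" n]
    by (simp add: big_vec_def)
qed

lemma small_vec_norm: "small_vec F n f \<Longrightarrow> (\<lambda>x. norm (f x)) \<in> o[F](n)"
proof -
  assume f: "small_vec F n f"
  have "(\<lambda>x. \<Sum>i\<in>UNIV. \<bar>f x $ i\<bar>) \<in> o[F](n)"
    using f by (intro big_sum_in_smallo) (auto simp: small_vec_def)
  moreover have "(\<lambda>x. norm (f x)) \<in> O[F](\<lambda>x. \<Sum>i\<in>UNIV. \<bar>f x $ i\<bar>)"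
    by (intro bigoI[of _ 1] always_eventually) (simp add: norm_le_l1_cart sum_nonneg)
  ultimately show ?thesis
    by (rule landau_o.big_small_trans[rotated])
qed

lemma big_vec_tendsto_0:
  assumes "big_vec F n f" "(n \<longlongrightarrow> 0) F"
  shows "(f \<longlongrightarrow> 0) F"
proof (rule vec_tendstoI)
  fix i
  have "n \<in> o[F](\<lambda>_. 1)"
    using assms(2) by (intro smalloI_tendsto) auto
  then have "(\<lambda>x. f x $ i) \<in> o[F](\<lambda>_. 1)"
    using assms(1) by (auto simp: big_vec_def intro: landau_o.big_small_trans)
  then show "((\<lambda>x. f x $ i) \<longlongrightarrow> 0 $ i) F"
    using smalloD_tendsto by fastforce
qed

lemma small_vec_l1norm_bound:
  assumes "eventually (\<lambda>x. l1norm (e x) \<le> l1norm (c x)) F" "small_vec F n c"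
  shows "small_vec F n e"
  unfolding small_vec_def
proof
  fix i
  have "(\<lambda>x. l1norm (c x)) \<in> o[F](n)"
    using assms(2) unfolding l1norm_def by (intro big_sum_in_smallo) (auto simp: small_vec_def)
  moreover have "(\<lambda>x. e x $ i) \<in> O[F](\<lambda>x. l1norm (c x))"
  proof (rule bigoI[of _ 1])
    show "eventually (\<lambda>x. norm (e x $ i) \<le> 1 * norm (l1norm (c x))) F"
      using assms(1)
    proof eventually_elim
      case (elim x)
      have "\<bar>e x $ i\<bar> \<le> l1norm (e x)"
        unfolding l1norm_def by (rule member_le_sum) auto
      with elim show ?case by simp
    qed
  qed
  ultimately show "(\<lambda>x. e x $ i) \<in> o[F](n)"
    by (rule landau_o.big_small_trans[rotated])
qed

lemma big_vec_l1norm_bound: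
  assumes "eventually (\<lambda>x. l1norm (e x) \<le> l1norm (c x)) F" "big_vec F n c"
  shows "big_vec F n e"
  unfolding big_vec_def
proof
  fix i
  have "(\<lambda>x. l1norm (c x)) \<in> O[F](n)"
    using assms(2) unfolding l1norm_def by (intro big_sum_in_bigo) (auto simp: big_vec_def)
  moreover have "(\<lambda>x. e x $ i) \<in> O[F](\<lambda>x. l1norm (c x))"
  proof (rule bigoI[of _ 1])
    show "eventually (\<lambda>x. norm (e x $ i) \<le> 1 * norm (l1norm (c x))) F"
      using assms(1)
    proof eventually_elim
      case (elim x)
      have "\<bar>e x $ i\<bar> \<le> l1norm (e x)"
        unfolding l1norm_def by (rule member_le_sum) auto
      with elim show ?case by simp
    qed
  qed
  ultimately show "(\<lambda>x. e x $ i) \<in> O[F](n)"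
    by (rule landau_o.big_trans[rotated])
qed

text \<open>The filter \<open>F\<close> lets the pair \<open>(y, z)\<close> tend to \<open>(ystar, ystar)\<close> with \<open>z\<close> in the kernel. Both points vary, so that
  expansions in powers of \<open>y - z\<close> are uniform in the equilibrium \<open>z\<close>.\<close>
locale perturbed_equilibrium =
  fixes Z :: "real ^ 'n ^ 'n" and F :: "'b filter" and y z :: "'b \<Rightarrow> real ^ 'n" and ystar :: "real ^ 'n"
  assumes Z: "conservative Z" and pos: "vpos ystar"
    and ker: "eventually (\<lambda>x. Z *v z x = 0) F"
    and y: "(y \<longlongrightarrow> ystar) F" and z: "(z \<longlongrightarrow> ystar) F"
begin

abbreviation "dist_yz \<equiv> (\<lambda>x. norm (y x - z x))"

lemma dist_tendsto_0: "(dist_yz \<longlongrightarrow> 0) F"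
  using tendsto_norm[OF tendsto_diff[OF y z]] by simp

lemma big_vec_linear:
  assumes "linear L"
  shows "big_vec F dist_yz (\<lambda>x. L (y x - z x))"
proof -
  obtain K where K: "\<And>v. norm (L v) \<le> norm v * K"
    using assms linear_conv_bounded_linear bounded_linear.bounded by blast
  show ?thesis
    unfolding big_vec_def
  proof (intro allI bigoI[of _ K] always_eventually)
    fix i x
    show "norm (L (y x - z x) $ i) \<le> K * norm (norm (y x - z x))"
      using component_le_norm_cart[of "L (y x - z x)" i] K[of "y x - z x"] by (simp add: mult.commute)
  qed
qed

lemma big_vec_diff_yz: "big_vec F dist_yz (\<lambda>x. y x - z x)"
  using big_vec_linear[of "\<lambda>v. v"] by (simp add: linear_id[unfolded id_def])

text \<open>First order expansion \<open>Y = z + \<eta> + o(y - z)\<close> of the solution of one Patankar stage, where \<open>\<kappa>\<close> is the linear part of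
  \<open>(w - s) * z\<close> and \<open>\<eta>\<close> solves the linearized equation. Since \<open>Z *v z = 0\<close>, both \<open>Y - z\<close> and the
  remainder solve stage equations whose right-hand sides are \<open>O(y - z)\<close> and \<open>o(y - z)\<close>, and
  the 1-norm estimate of the resolvent carries these orders over to the solutions.\<close>
lemma stage_expansion:
  assumes w: "\<And>i. ((\<lambda>x. w x $ i) \<longlongrightarrow> s) F" and s: "0 < s"
    and Y: "eventually (\<lambda>x. Y x = y x + Z *v (w x * Y x)) F"
    and \<kappa>: "big_vec F dist_yz \<kappa>" "small_vec F dist_yz (\<lambda>x. (w x - const_vec s) * z x - \<kappa> x)"
    and \<eta>: "\<And>x. \<eta> x - s *s (Z *v \<eta> x) = (y x - z x) + Z *v \<kappa> x"
  shows "small_vec F dist_yz (\<lambda>x. Y x - z x - \<eta> x)" "big_vec F dist_yz \<eta>"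
proof -
  have wpos: "eventually (\<lambda>x. \<forall>i. 0 \<le> w x $ i) F"
    by (intro eventually_all_finite eventually_mono[OF order_tendstoD(1)[OF w s]] less_imp_le)
  have E: "eventually (\<lambda>x. (Y x - z x) - Z *v (w x * (Y x - z x))
      = (y x - z x) + Z *v ((w x - const_vec s) * z x)) F"
    using Y ker
  proof eventually_elim
    case (elim x)
    then show ?case
      by (simp add: mult_vec_distrib mult_const_vec vec.add vec.diff algebra_simps)
  qed
  have "big_vec F dist_yz (\<lambda>x. ((w x - const_vec s) * z x - \<kappa> x) + \<kappa> x)"
    by (rule big_vec_add[OF small_vec_imp_big_vec[OF \<kappa>(2)] \<kappa>(1)])
  then have "big_vec F dist_yz (\<lambda>x. (y x - z x) + Z *v ((w x - const_vec s) * z x))"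
    by (intro big_vec_add big_vec_diff_yz big_vec_matrix_mult) simp
  then have bigE: "big_vec F dist_yz (\<lambda>x. Y x - z x)"
    by (rule big_vec_l1norm_bound[rotated]) (use E wpos in eventually_elim, rule resolvent_l1[OF Z], auto)
  have "big_vec F dist_yz (\<lambda>x. (y x - z x) + Z *v \<kappa> x)"
    by (intro big_vec_add big_vec_diff_yz big_vec_matrix_mult \<kappa>)
  then show "big_vec F dist_yz \<eta>"
  proof (rule big_vec_l1norm_bound[rotated], intro always_eventually allI)
    fix x
    show "l1norm (\<eta> x) \<le> l1norm (y x - z x + Z *v \<kappa> x)"
      by (rule resolvent_l1[OF Z, of "const_vec s"])
         (use s \<eta> in \<open>simp_all add: mult_const_vec\<close>, simp add: const_vec_def)
  qed
  have "small_vec F dist_yz (\<lambda>x. (w x - const_vec s) * (Y x - z x))"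
    using w bigE by (intro small_vec_mult) (auto simp: const_vec_def LIM_zero)
  with \<kappa> have "small_vec F dist_yz (\<lambda>x. Z *v ((w x - const_vec s) * z x - \<kappa> x)
      + Z *v ((w x - const_vec s) * (Y x - z x)))"
    by (intro small_vec_add small_vec_matrix_mult)
  then show "small_vec F dist_yz (\<lambda>x. Y x - z x - \<eta> x)"
  proof (rule small_vec_l1norm_bound[rotated])
    show "eventually (\<lambda>x. l1norm (Y x - z x - \<eta> x) \<le> l1norm (Z *v ((w x - const_vec s) * z x - \<kappa> x)
      + Z *v ((w x - const_vec s) * (Y x - z x)))) F"
      using E
    proof eventually_elim
      case (elim x)
      have "(Y x - z x - \<eta> x) - Z *v (const_vec s * (Y x - z x - \<eta> x))
        = (Y x - z x) - Z *v (const_vec s * (Y x - z x)) - (\<eta> x - s *s (Z *v \<eta> x))"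
        by (simp add: mult_vec_distrib mult_const_vec vec.diff algebra_simps)
      also have "(Y x - z x) - Z *v (const_vec s * (Y x - z x))
        = (y x - z x) + Z *v ((w x - const_vec s) * z x) + Z *v ((w x - const_vec s) * (Y x - z x))"
        using elim by (simp add: mult_vec_distrib vec.diff algebra_simps)
      finally have "(Y x - z x - \<eta> x) - Z *v (const_vec s * (Y x - z x - \<eta> x))
        = Z *v ((w x - const_vec s) * z x - \<kappa> x) + Z *v ((w x - const_vec s) * (Y x - z x))"
        unfolding \<eta> by (simp add: vec.diff algebra_simps)
      then show ?case
        by (rule resolvent_l1[OF Z, rotated]) (use s in \<open>simp add: const_vec_def\<close>)
    qed
  qed
qed

text \<open>To first order \<open>(Y / y - 1) * z\<close> is \<open>Y - y\<close>, because \<open>z / y\<close> tends to 1.\<close>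
lemma ratio_expansion:
  assumes Y: "small_vec F dist_yz (\<lambda>x. Y x - z x - \<eta> x)" and \<eta>: "big_vec F dist_yz \<eta>"
  shows "(Y \<longlongrightarrow> ystar) F" "((\<lambda>x. Y x $ i / y x $ i) \<longlongrightarrow> 1) F"
    and "(\<lambda>x. (Y x $ i / y x $ i - 1) * z x $ i - (\<eta> x - (y x - z x)) $ i) \<in> o[F](dist_yz)"
proof -
  have bigE: "big_vec F dist_yz (\<lambda>x. Y x - z x)"
    using big_vec_add[OF small_vec_imp_big_vec[OF Y] \<eta>] by simp
  from tendsto_add[OF big_vec_tendsto_0[OF this dist_tendsto_0] z]
  show Ylim: "(Y \<longlongrightarrow> ystar) F" by simp
  have ypos: "0 < ystar $ i" for i
    using pos by (simp add: vpos_def)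
  then have ne: "ystar $ i \<noteq> 0" by (metis less_irrefl)
  have evy: "eventually (\<lambda>x. 0 < y x $ i) F"
    using order_tendstoD(1)[OF tendsto_vec_nth[OF y] ypos] .
  show "((\<lambda>x. Y x $ i / y x $ i) \<longlongrightarrow> 1) F"
    using tendsto_divide[OF tendsto_vec_nth[OF Ylim, of i] tendsto_vec_nth[OF y, of i] ne] ne by simp
  have zy: "((\<lambda>x. z x $ i / y x $ i) \<longlongrightarrow> 1) F"
    using tendsto_divide[OF tendsto_vec_nth[OF z, of i] tendsto_vec_nth[OF y, of i] ne] ne by simp
  have Yy: "(\<lambda>x. (Y x - z x) $ i - (y x - z x) $ i) \<in> O[F](dist_yz)"
    using bigE big_vec_diff_yz by (intro sum_in_bigo) (auto simp: big_vec_def)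
  have "(\<lambda>x. z x $ i / y x $ i - 1) \<in> o[F](\<lambda>_. 1)"
    using zy by (intro smalloI_tendsto) (auto simp: LIM_zero)
  from landau_o.small_big_mult[OF this Yy]
  have "(\<lambda>x. (z x $ i / y x $ i - 1) * ((Y x - z x) $ i - (y x - z x) $ i)) \<in> o[F](dist_yz)"
    by simp
  moreover have "(\<lambda>x. (Y x - z x - \<eta> x) $ i) \<in> o[F](dist_yz)"
    using Y by (simp add: small_vec_def)
  ultimately have "(\<lambda>x. (z x $ i / y x $ i - 1) * ((Y x - z x) $ i - (y x - z x) $ i)
      + (Y x - z x - \<eta> x) $ i) \<in> o[F](dist_yz)"
    by (rule sum_in_smallo)
  then show "(\<lambda>x. (Y x $ i / y x $ i - 1) * z x $ i - (\<eta> x - (y x - z x)) $ i) \<in> o[F](dist_yz)"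
  proof (rule landau_o.small.in_cong[THEN iffD1, rotated])
    show "eventually (\<lambda>x. (z x $ i / y x $ i - 1) * ((Y x - z x) $ i - (y x - z x) $ i)
      + (Y x - z x - \<eta> x) $ i = (Y x $ i / y x $ i - 1) * z x $ i - (\<eta> x - (y x - z x)) $ i) F"
      using evy by eventually_elim (simp add: field_simps)
  qed
qed

text \<open>The weight is a function \<open>\<phi>\<close> of the ratio \<open>Y / y\<close>, which tends to 1 uniformly in \<open>z\<close>; so differentiability of \<open>\<phi>\<close>
  at the single point 1 suffices.\<close>
lemma weight_expansion:
  assumes Y: "small_vec F dist_yz (\<lambda>x. Y x - z x - \<eta> x)" and \<eta>: "big_vec F dist_yz \<eta>"
    and \<phi>: "(\<phi> has_real_derivative c) (at 1)"
  defines "w \<equiv> (\<lambda>x. \<chi> i. \<phi> (Y x $ i / y x $ i))"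
  shows "((\<lambda>x. w x $ i) \<longlongrightarrow> \<phi> 1) F"
    and "small_vec F dist_yz (\<lambda>x. (w x - const_vec (\<phi> 1)) * z x - c *s (\<eta> x - (y x - z x)))"
proof -
  \<comment> \<open>The difference quotient \<open>g\<close> of Caratheodory avoids division by \<open>r - 1\<close>, which vanishes when \<open>Y = y\<close>.\<close>
  obtain g where g: "\<And>r. \<phi> r - \<phi> 1 = g r * (r - 1)" "isCont g 1" "g 1 = c"
    using \<phi> unfolding CARAT_DERIV by auto
  note r = ratio_expansion[OF Y \<eta>]
  show "((\<lambda>x. w x $ i) \<longlongrightarrow> \<phi> 1) F"
    using isCont_tendsto_compose[OF DERIV_isCont[OF \<phi>] r(2)] by (simp add: w_def)
  show "small_vec F dist_yz (\<lambda>x. (w x - const_vec (\<phi> 1)) * z x - c *s (\<eta> x - (y x - z x)))"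
    unfolding small_vec_def
  proof
    fix i
    let ?r = "\<lambda>x. Y x $ i / y x $ i"
    define e where "e x = (\<eta> x - (y x - z x)) $ i" for x
    have glim: "((\<lambda>x. g (?r x)) \<longlongrightarrow> c) F"
      using isCont_tendsto_compose[OF g(2) r(2)] g(3) by simp
    have "(\<lambda>x. g (?r x)) \<in> O[F](\<lambda>_. 1)"
      using glim by (intro bigoI_tendsto[of _ _ c]) auto
    from landau_o.big_small_mult[OF this r(3)[of i, folded e_def]]
    have 1: "(\<lambda>x. g (?r x) * ((?r x - 1) * z x $ i - e x)) \<in> o[F](dist_yz)"
      by simp
    have "(\<lambda>x. g (?r x) - c) \<in> o[F](\<lambda>_. 1)"
      using glim by (intro smalloI_tendsto) (auto simp: LIM_zero)
    moreover have "e \<in> O[F](dist_yz)"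
      using big_vec_diff[OF \<eta> big_vec_diff_yz] unfolding e_def big_vec_def by blast
    ultimately have "(\<lambda>x. (g (?r x) - c) * e x) \<in> o[F](dist_yz)"
      using landau_o.small_big_mult by fastforce
    from sum_in_smallo(1)[OF 1 this]
    show "(\<lambda>x. ((w x - const_vec (\<phi> 1)) * z x - c *s (\<eta> x - (y x - z x))) $ i) \<in> o[F](dist_yz)"
    proof (rule back_subst[of "\<lambda>f. f \<in> _"], intro ext)
      fix x
      have "((w x - const_vec (\<phi> 1)) * z x - c *s (\<eta> x - (y x - z x))) $ i
          = (\<phi> (?r x) - \<phi> 1) * z x $ i - c * e x"
        by (simp add: w_def const_vec_def e_def algebra_simps)
      also have "\<dots> = g (?r x) * (?r x - 1) * z x $ i - c * e x"
        by (simp only: g(1))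
      finally have eq: "((w x - const_vec (\<phi> 1)) * z x - c *s (\<eta> x - (y x - z x))) $ i
          = g (?r x) * (?r x - 1) * z x $ i - c * e x" .
      show "g (?r x) * ((?r x - 1) * z x $ i - e x) + (g (?r x) - c) * e x
          = ((w x - const_vec (\<phi> 1)) * z x - c *s (\<eta> x - (y x - z x))) $ i"
        unfolding eq by (simp add: algebra_simps)
    qed
  qed
qed


lemma eventually_weight_pos:
  fixes s :: real
  assumes "\<And>i. ((\<lambda>x. w x $ i) \<longlongrightarrow> s) F" "0 < s"
  shows "eventually (\<lambda>x. \<forall>i. 0 < w x $ i) F"
  by (intro eventually_all_finite order_tendstoD(1)[OF assms])

lemma eventually_vpos:
  assumes "(Y \<longlongrightarrow> ystar) F"
  shows "eventually (\<lambda>x. vpos (Y x)) F"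
  unfolding vpos_def
  by (intro eventually_all_finite order_tendstoD(1)[OF tendsto_vec_nth[OF assms]])
     (use pos in \<open>simp add: vpos_def\<close>)

lemma final_weight_expansion:
  assumes Y1: "small_vec F dist_yz (\<lambda>x. Y1 x - z x - \<eta>1 x)" and \<eta>1: "big_vec F dist_yz \<eta>1"
    and Y2: "small_vec F dist_yz (\<lambda>x. Y2 x - z x - \<eta>2 x)" and \<eta>2: "big_vec F dist_yz \<eta>2"
    and Y3: "small_vec F dist_yz (\<lambda>x. Y3 x - z x - \<eta>3 x)" and \<eta>3: "big_vec F dist_yz \<eta>3"
    and b: "c1 + c2 + c3 = 1"
  defines "w \<equiv> (\<lambda>x. \<chi> i. (c1 + c2 * (Y1 x $ i / y x $ i) + c3 * (Y2 x $ i / y x $ i)) / (Y3 x $ i / y x $ i))"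
  defines "\<kappa> \<equiv> (\<lambda>x. c2 *s (\<eta>1 x - (y x - z x)) + c3 *s (\<eta>2 x - (y x - z x)) - (\<eta>3 x - (y x - z x)))"
  shows "((\<lambda>x. w x $ i) \<longlongrightarrow> 1) F"
    and "small_vec F dist_yz (\<lambda>x. (w x - const_vec 1) * z x - \<kappa> x)"
proof -
  note r1 = ratio_expansion[OF Y1 \<eta>1] and r2 = ratio_expansion[OF Y2 \<eta>2] and r3 = ratio_expansion[OF Y3 \<eta>3]
  have c1: "c1 = 1 - c2 - c3"
    using b by simp
  have "((\<lambda>x. (c1 + c2 * (Y1 x $ i / y x $ i) + c3 * (Y2 x $ i / y x $ i)) / (Y3 x $ i / y x $ i))
      \<longlongrightarrow> (c1 + c2 * 1 + c3 * 1) / 1) F"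
    by (intro tendsto_intros r1 r2 r3) simp
  then show "((\<lambda>x. w x $ i) \<longlongrightarrow> 1) F"
    by (simp add: w_def b)
  show "small_vec F dist_yz (\<lambda>x. (w x - const_vec 1) * z x - \<kappa> x)"
    unfolding small_vec_def
  proof
    fix i
    define p1 p2 p3 where "p1 x = (Y1 x $ i / y x $ i - 1) * z x $ i"
      and "p2 x = (Y2 x $ i / y x $ i - 1) * z x $ i" and "p3 x = (Y3 x $ i / y x $ i - 1) * z x $ i" for x
    define q where "q x = 1 / (Y3 x $ i / y x $ i)" for x
    have q: "(q \<longlongrightarrow> 1) F"
      unfolding q_def using tendsto_divide[OF tendsto_const r3(2), of 1] by simp
    have "(\<lambda>x. c2 * (p1 x - (\<eta>1 x - (y x - z x)) $ i) + c3 * (p2 x - (\<eta>2 x - (y x - z x)) $ i)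
        - (p3 x - (\<eta>3 x - (y x - z x)) $ i)) \<in> o[F](dist_yz)"
      by (intro sum_in_smallo(2)[OF sum_in_smallo(1)] small_cmult r1(3)[of i, folded p1_def] r2(3)[of i, folded p2_def] r3(3)[of i, folded p3_def])
    moreover have "q \<in> O[F](\<lambda>_. 1)"
      using q by (intro bigoI_tendsto[of _ _ 1]) auto
    ultimately have 1: "(\<lambda>x. q x * (c2 * (p1 x - (\<eta>1 x - (y x - z x)) $ i) + c3 * (p2 x - (\<eta>2 x - (y x - z x)) $ i)
        - (p3 x - (\<eta>3 x - (y x - z x)) $ i))) \<in> o[F](dist_yz)"
      using landau_o.big_small_mult by fastforce
    have "(\<lambda>x. q x - 1) \<in> o[F](\<lambda>_. 1)"
      using q by (intro smalloI_tendsto) (auto simp: LIM_zero)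
    moreover have "big_vec F dist_yz \<kappa>"
      unfolding \<kappa>_def by (intro big_vec_add big_vec_diff big_vec_scale big_vec_diff_yz \<eta>1 \<eta>2 \<eta>3)
    then have "(\<lambda>x. \<kappa> x $ i) \<in> O[F](dist_yz)"
      by (simp add: big_vec_def)
    ultimately have 2: "(\<lambda>x. (q x - 1) * \<kappa> x $ i) \<in> o[F](dist_yz)"
      using landau_o.small_big_mult by fastforce
    have "eventually (\<lambda>x. 0 < Y3 x $ i / y x $ i) F"
      using order_tendstoD(1)[OF r3(2), of 0] by simp
    then have "eventually (\<lambda>x. q x * (c2 * (p1 x - (\<eta>1 x - (y x - z x)) $ i) + c3 * (p2 x - (\<eta>2 x - (y x - z x)) $ i)
        - (p3 x - (\<eta>3 x - (y x - z x)) $ i)) + (q x - 1) * \<kappa> x $ i = ((w x - const_vec 1) * z x - \<kappa> x) $ i) F"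
    proof eventually_elim
      case (elim x)
      have "q x * (c2 * (p1 x - (\<eta>1 x - (y x - z x)) $ i) + c3 * (p2 x - (\<eta>2 x - (y x - z x)) $ i)
        - (p3 x - (\<eta>3 x - (y x - z x)) $ i)) + (q x - 1) * \<kappa> x $ i = q x * (c2 * p1 x + c3 * p2 x - p3 x) - \<kappa> x $ i"
        by (simp add: \<kappa>_def algebra_simps)
      moreover have "(w x - const_vec 1) $ i * z x $ i = q x * (c2 * p1 x + c3 * p2 x - p3 x)"
      proof -
        define R1 R2 R3 where "R1 = Y1 x $ i / y x $ i" and "R2 = Y2 x $ i / y x $ i" and "R3 = Y3 x $ i / y x $ i"
        have "0 < R3" using elim by (simp add: R3_def)
        then have "((c1 + c2 * R1 + c3 * R2) / R3 - 1) * z x $ i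
            = 1 / R3 * (c2 * ((R1 - 1) * z x $ i) + c3 * ((R2 - 1) * z x $ i) - (R3 - 1) * z x $ i)"
          by (simp add: c1 field_simps)
        then show ?thesis
          by (simp add: w_def const_vec_def q_def p1_def p2_def p3_def R1_def R2_def R3_def)
      qed
      ultimately show ?case by simp
    qed
    then show "(\<lambda>x. ((w x - const_vec 1) * z x - \<kappa> x) $ i) \<in> o[F](dist_yz)"
      by (rule landau_o.small.in_cong[THEN iffD1]) (rule sum_in_smallo(1)[OF 1 2])
  qed
qed

text \<open>If \<open>y - z = D(Z) h\<close> and the linear part of the weight is \<open>K(Z) h\<close>, then the linearized stage value is \<open>P(Z) h\<close>,
  where \<open>P\<close> solves the stage equation in the commutative ring of polynomials. Expressing all stages through
  \<open>h\<close> thus replaces operator algebra by polynomial identities.\<close>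
lemma stage_expansion_poly:
  assumes w: "\<And>i. ((\<lambda>x. w x $ i) \<longlongrightarrow> s) F" and s: "0 < s"
    and Y: "eventually (\<lambda>x. Y x = y x + Z *v (w x * Y x)) F"
    and h: "big_vec F dist_yz h" "\<And>x. op_poly Z D (h x) = y x - z x"
    and K: "small_vec F dist_yz (\<lambda>x. (w x - const_vec s) * z x - op_poly Z K (h x))"
    and P: "[:1, - s:] * P = D + [:0, 1:] * K"
  shows "small_vec F dist_yz (\<lambda>x. Y x - z x - op_poly Z P (h x))"
    and "big_vec F dist_yz (\<lambda>x. op_poly Z P (h x))"
proof -
  have "op_poly Z P (h x) - s *s (Z *v op_poly Z P (h x)) = y x - z x + Z *v op_poly Z K (h x)" for x
  proof -
    have "op_poly Z ([:1, - s:] * P) (h x) = op_poly Z (D + [:0, 1:] * K) (h x)"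
      by (simp only: P)
    then show ?thesis
      unfolding op_poly_mult op_poly_add h(2) by (simp add: vec.neg vec.scale)
  qed
  from stage_expansion[OF w s Y big_vec_op_poly[OF h(1)] K this]
  show "small_vec F dist_yz (\<lambda>x. Y x - z x - op_poly Z P (h x))"
    and "big_vec F dist_yz (\<lambda>x. op_poly Z P (h x))" .
qed

end

section \<open>Linearization of the MPRK43 scheme\<close>

text \<open>The first four equations are the conditions of third order on the underlying Runge-Kutta scheme with
  nodes \<open>0\<close>, \<open>\<alpha>\<close>, \<open>\<beta>\<close>; the last one is what the exponent \<open>mprk_p\<close> is chosen for: it makes the second
  weight have derivative \<open>- a32\<close> at 1.\<close>
lemma order_conditions:
  assumes "0 < \<alpha>" "0 < \<beta>" "\<alpha> \<noteq> \<beta>" "\<alpha> \<noteq> 2/3"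
  shows "b1 \<alpha> \<beta> + b2 \<alpha> \<beta> + b3 \<alpha> \<beta> = 1"
    and "b2 \<alpha> \<beta> * \<alpha> + b3 \<alpha> \<beta> * \<beta> = 1/2"
    and "(b2 \<alpha> \<beta> + b3 \<alpha> \<beta>) * (\<alpha> * \<beta>) = (\<alpha> + \<beta>) / 2 - 1/3"
    and "b3 \<alpha> \<beta> * (a32 \<alpha> \<beta> * \<alpha>) = 1/6"
    and "a31 \<alpha> \<beta> + a32 \<alpha> \<beta> = \<beta>"
    and "\<beta> / mprk_p \<alpha> \<beta> = 2 * a32 \<alpha> \<beta>"
proof -
  have ne: "\<alpha> \<noteq> 0" "\<beta> \<noteq> 0" "\<beta> - \<alpha> \<noteq> 0" "2 - 3 * \<alpha> \<noteq> 0"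
    using assms by auto
  show "b1 \<alpha> \<beta> + b2 \<alpha> \<beta> + b3 \<alpha> \<beta> = 1"
    using ne by (simp add: b1_def b2_def b3_def divide_simps) (simp add: algebra_simps)
  show "b2 \<alpha> \<beta> * \<alpha> + b3 \<alpha> \<beta> * \<beta> = 1/2"
    using ne by (simp add: b2_def b3_def divide_simps)
  show "(b2 \<alpha> \<beta> + b3 \<alpha> \<beta>) * (\<alpha> * \<beta>) = (\<alpha> + \<beta>) / 2 - 1/3"
    using ne by (simp add: b2_def b3_def divide_simps) (simp add: algebra_simps)
  show "b3 \<alpha> \<beta> * (a32 \<alpha> \<beta> * \<alpha>) = 1/6"
    using ne by (simp add: a32_def b3_def divide_simps)
  show sum: "a31 \<alpha> \<beta> + a32 \<alpha> \<beta> = \<beta>"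
    using ne by (simp add: a31_def a32_def divide_simps) (simp add: algebra_simps power2_eq_square)
  have p: "mprk_p \<alpha> \<beta> = 3 * \<alpha> * \<beta> * b3 \<alpha> \<beta>"
    by (simp add: mprk_p_def sum a21_def)
  show "\<beta> / mprk_p \<alpha> \<beta> = 2 * a32 \<alpha> \<beta>"
    unfolding p using ne by (simp add: a32_def b3_def divide_simps)
qed

text \<open>To first order the \<open>k\<close>-th stage value at \<open>z + d\<close> is \<open>z + P(Z) D(Z)\<^sup>-\<^sup>1 d\<close>. This polynomial \<open>P\<close> and its two companions below
  are the numerators of the first three stages over the common denominator \<open>D\<close>.\<close>
definition stage1_num :: "real \<Rightarrow> real \<Rightarrow> real poly" where
  "stage1_num \<alpha> \<beta> = [:1, - \<beta>:] * [:1, - 1:] ^ 2"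

definition stage2_num :: "real \<Rightarrow> real \<Rightarrow> real poly" where
  "stage2_num \<alpha> \<beta> = [:1, - \<alpha>, - (a32 \<alpha> \<beta> * \<alpha>):] * [:1, - 1:] ^ 2"

definition stage3_num :: "real \<Rightarrow> real \<Rightarrow> real poly" where
  "stage3_num \<alpha> \<beta> = [:1, - \<beta>:] * [:1, - 1:] * [:1, - \<alpha>, - 1/2:]"

lemma stage_num_equations:
  assumes "0 < \<alpha>" "0 < \<beta>" "\<alpha> \<noteq> \<beta>" "\<alpha> \<noteq> 2/3"
  shows "[:1, - \<alpha>:] * stage1_num \<alpha> \<beta> = stab_den \<alpha> \<beta> + [:0, 1:] * 0"
    and "[:1, - \<beta>:] * stage2_num \<alpha> \<beta>
      = stab_den \<alpha> \<beta> + [:0, 1:] * smult (- a32 \<alpha> \<beta>) (stage1_num \<alpha> \<beta> - stab_den \<alpha> \<beta>)"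
    and "[:1, - 1:] * stage3_num \<alpha> \<beta>
      = stab_den \<alpha> \<beta> + [:0, 1:] * smult (- (1 / (2 * \<alpha>))) (stage1_num \<alpha> \<beta> - stab_den \<alpha> \<beta>)"
    and "[:1, - 1:] * stab_num \<alpha> \<beta> = stab_den \<alpha> \<beta> + [:0, 1:] *
      (smult (b2 \<alpha> \<beta>) (stage1_num \<alpha> \<beta> - stab_den \<alpha> \<beta>)
       + smult (b3 \<alpha> \<beta>) (stage2_num \<alpha> \<beta> - stab_den \<alpha> \<beta>) - (stage3_num \<alpha> \<beta> - stab_den \<alpha> \<beta>))"
proof -
  show "[:1, - \<alpha>:] * stage1_num \<alpha> \<beta> = stab_den \<alpha> \<beta> + [:0, 1:] * 0"
    by (simp only: stage1_num_def stab_den_def mult_zero_right add_0_right mult.assoc)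
  have 1: "stage1_num \<alpha> \<beta> - stab_den \<alpha> \<beta> = [:0, \<alpha>, - (\<alpha> * \<beta>):] * [:1, - 1:] ^ 2"
    by (simp add: stage1_num_def stab_den_def power2_eq_square algebra_simps)
  have 2: "stage2_num \<alpha> \<beta> - stab_den \<alpha> \<beta> = [:0, \<beta>, - (\<alpha> * \<beta> + a32 \<alpha> \<beta> * \<alpha>):] * [:1, - 1:] ^ 2"
    by (simp add: stage2_num_def stab_den_def power2_eq_square algebra_simps)
  show "[:1, - \<beta>:] * stage2_num \<alpha> \<beta>
      = stab_den \<alpha> \<beta> + [:0, 1:] * smult (- a32 \<alpha> \<beta>) (stage1_num \<alpha> \<beta> - stab_den \<alpha> \<beta>)"
    unfolding 1 by (simp add: stage2_num_def stab_den_def power2_eq_square algebra_simps)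
  show "[:1, - 1:] * stage3_num \<alpha> \<beta>
      = stab_den \<alpha> \<beta> + [:0, 1:] * smult (- (1 / (2 * \<alpha>))) (stage1_num \<alpha> \<beta> - stab_den \<alpha> \<beta>)"
    unfolding 1 using assms by (simp add: stage3_num_def stab_den_def power2_eq_square field_simps)
  have "smult (b2 \<alpha> \<beta>) [:0, \<alpha>, - (\<alpha> * \<beta>):] + smult (b3 \<alpha> \<beta>) [:0, \<beta>, - (\<alpha> * \<beta> + a32 \<alpha> \<beta> * \<alpha>):]
      = [:0, b2 \<alpha> \<beta> * \<alpha> + b3 \<alpha> \<beta> * \<beta>, - ((b2 \<alpha> \<beta> + b3 \<alpha> \<beta>) * (\<alpha> * \<beta>) + b3 \<alpha> \<beta> * (a32 \<alpha> \<beta> * \<alpha>)):]"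
    by (simp add: algebra_simps)
  also have "\<dots> = [:0, 1/2, 1/6 - (\<alpha> + \<beta>) / 2:]"
    unfolding order_conditions[OF assms] by simp
  finally have "smult (b2 \<alpha> \<beta>) (stage1_num \<alpha> \<beta> - stab_den \<alpha> \<beta>) + smult (b3 \<alpha> \<beta>) (stage2_num \<alpha> \<beta> - stab_den \<alpha> \<beta>)
      = [:0, 1/2, 1/6 - (\<alpha> + \<beta>) / 2:] * [:1, - 1:] ^ 2"
    unfolding 1 2 by (simp only: mult_smult_left[symmetric] distrib_right[symmetric])
  then show "[:1, - 1:] * stab_num \<alpha> \<beta> = stab_den \<alpha> \<beta> + [:0, 1:] *
      (smult (b2 \<alpha> \<beta>) (stage1_num \<alpha> \<beta> - stab_den \<alpha> \<beta>)
       + smult (b3 \<alpha> \<beta>) (stage2_num \<alpha> \<beta> - stab_den \<alpha> \<beta>) - (stage3_num \<alpha> \<beta> - stab_den \<alpha> \<beta>))"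
    by (simp only:) (simp add: stage3_num_def stab_num_def stab_den_def power2_eq_square field_simps)
qed

definition patankar :: "real ^ 'n ^ 'n \<Rightarrow> real ^ 'n \<Rightarrow> real ^ 'n \<Rightarrow> real ^ 'n" where
  "patankar Z w y = (THE x. x = y + Z *v (w * x))"

lemma patankar_iff:
  assumes "conservative Z" "\<forall>i. 0 < w $ i"
  shows "z = y + Z *v (w * z) \<longleftrightarrow> z = patankar Z w y"
proof -
  have ex1: "\<exists>!x. x = y + Z *v (w * x)"
    using assms by (intro patankar_ex1) (auto intro: less_imp_le)
  then show ?thesis
    unfolding patankar_def using theI'[OF ex1] by blast
qed

lemma patankar_eq:
  "conservative Z \<Longrightarrow> \<forall>i. 0 < w $ i \<Longrightarrow> patankar Z w y = y + Z *v (w * patankar Z w y)"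
  using patankar_iff by blast

lemma diag_mult_vec: "diag u *v v = u * v"
  by (simp add: vec_eq_iff diag_def matrix_vector_mult_def if_distrib[of "\<lambda>a. a * _"] sum.delta cong: if_cong)

lemma mprk_stage_term:
  "t *\<^sub>R ((A ** diag x ** diag_powr u a ** diag_powr v b) *v c)
    = (t *\<^sub>R A) *v ((\<chi> i. u $ i powr a * v $ i powr b * c $ i) * x)"
  "t *\<^sub>R ((A ** diag x ** diag_powr u a) *v c) = (t *\<^sub>R A) *v ((\<chi> i. u $ i powr a * c $ i) * x)"
proof -
  have "diag x *v (diag_powr u a *v (diag_powr v b *v c)) = (\<chi> i. u $ i powr a * v $ i powr b * c $ i) * x"
    by (simp add: diag_powr_def diag_mult_vec vec_eq_iff mult_ac)
  then show "t *\<^sub>R ((A ** diag x ** diag_powr u a ** diag_powr v b) *v c)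
    = (t *\<^sub>R A) *v ((\<chi> i. u $ i powr a * v $ i powr b * c $ i) * x)"
    by (simp add: scaleR_matrix_vector_assoc flip: matrix_vector_mul_assoc)
  have "diag x *v (diag_powr u a *v c) = (\<chi> i. u $ i powr a * c $ i) * x"
    by (simp add: diag_powr_def diag_mult_vec vec_eq_iff mult_ac)
  then show "t *\<^sub>R ((A ** diag x ** diag_powr u a) *v c) = (t *\<^sub>R A) *v ((\<chi> i. u $ i powr a * c $ i) * x)"
    by (simp add: scaleR_matrix_vector_assoc flip: matrix_vector_mul_assoc)
qed

text \<open>The common form of the weights of the second and third stage, as functions of the ratio \<open>r = y1 / y\<close>.\<close>
definition patankar_weight :: "real \<Rightarrow> real \<Rightarrow> real \<Rightarrow> real \<Rightarrow> real" where
  "patankar_weight s a b r = r powr (- (1 / s)) * (a + b * r)"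

lemma patankar_weight_eq:
  assumes "0 < u" "0 < v"
  shows "u powr (- (1 / s)) * v powr (1 / s - 1) * (a * v + b * u) = patankar_weight s a b (u / v)"
  using assms unfolding patankar_weight_def
  by (simp add: powr_diff powr_minus powr_divide field_simps)

lemma patankar_weight_deriv:
  "(patankar_weight s a b has_real_derivative b - (a + b) / s) (at 1)"
proof -
  have "((\<lambda>r. r powr (- (1 / s)) * (a + b * r)) has_real_derivative b - (a + b) / s) (at 1)"
    by (auto intro!: derivative_eq_intros)
  then show ?thesis
    by (simp add: patankar_weight_def[abs_def])
qed

lemma patankar_weight_1: "patankar_weight s a b 1 = a + b"
  by (simp add: patankar_weight_def)

lemma patankar_unique_pos_solution:
  assumes "conservative Z" "\<forall>i. 0 < w $ i" "vpos (patankar Z w y)"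
    and "\<And>x. P x \<longleftrightarrow> x = y + Z *v (w * x)"
  shows "unique_pos_solution P (patankar Z w y)"
  unfolding unique_pos_solution_def assms(4) using assms(3) patankar_iff[OF assms(1,2)] by simp

lemma mprk43_step_patankar:
  fixes A :: "real ^ 'n ^ 'n" and \<alpha> \<beta> :: real
  assumes Z: "conservative (dt *\<^sub>R A)" and pos: "0 < \<alpha>" "vpos y"
  defines "Y1 \<equiv> patankar (dt *\<^sub>R A) (const_vec \<alpha>) y"
  defines "w2 \<equiv> \<chi> i. patankar_weight (mprk_p \<alpha> \<beta>) (a31 \<alpha> \<beta>) (a32 \<alpha> \<beta>) (Y1 $ i / y $ i)"
  defines "Y2 \<equiv> patankar (dt *\<^sub>R A) w2 y"
  defines "w3 \<equiv> \<chi> i. patankar_weight (mprk_q \<alpha> \<beta>) (beta1 \<alpha> \<beta>) (beta2 \<alpha> \<beta>) (Y1 $ i / y $ i)"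
  defines "Y3 \<equiv> patankar (dt *\<^sub>R A) w3 y"
  defines "w4 \<equiv> \<chi> i. (b1 \<alpha> \<beta> + b2 \<alpha> \<beta> * (Y1 $ i / y $ i) + b3 \<alpha> \<beta> * (Y2 $ i / y $ i)) / (Y3 $ i / y $ i)"
  defines "Y4 \<equiv> patankar (dt *\<^sub>R A) w4 y"
  assumes w: "\<forall>i. 0 < w2 $ i" "\<forall>i. 0 < w3 $ i" "\<forall>i. 0 < w4 $ i"
    and Y: "vpos Y1" "vpos Y2" "vpos Y3" "vpos Y4"
  shows "mprk43_step \<alpha> \<beta> dt A y Y4"
  unfolding mprk43_step_def
proof (intro conjI exI)
  have p: "0 < y $ i" "0 < Y1 $ i" "0 < Y3 $ i" for i
    using pos Y by (auto simp: vpos_def)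
  show "vpos y" by fact
  show "unique_pos_solution (\<lambda>x. x = y + (a21 \<alpha> \<beta> * dt) *\<^sub>R (A *v x)) Y1"
    unfolding Y1_def
  proof (rule patankar_unique_pos_solution[OF Z])
    show "x = y + (a21 \<alpha> \<beta> * dt) *\<^sub>R (A *v x) \<longleftrightarrow> x = y + (dt *\<^sub>R A) *v (const_vec \<alpha> * x)" for x
      by (simp add: mult_const_vec a21_def scalar_mult_eq_scaleR scaleR_matrix_vector_assoc[symmetric])
  qed (use pos Y in \<open>simp_all add: const_vec_def Y1_def\<close>)
  have w2: "(\<chi> i. Y1 $ i powr (- (1 / mprk_p \<alpha> \<beta>)) * y $ i powr (1 / mprk_p \<alpha> \<beta> - 1)
      * (a31 \<alpha> \<beta> *\<^sub>R y + a32 \<alpha> \<beta> *\<^sub>R Y1) $ i) = w2"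
    using p by (simp add: w2_def vec_eq_iff patankar_weight_eq)
  show "unique_pos_solution (\<lambda>x. x = y + dt *\<^sub>R ((A ** diag x ** diag_powr Y1 (- (1 / mprk_p \<alpha> \<beta>))
      ** diag_powr y (1 / mprk_p \<alpha> \<beta> - 1)) *v (a31 \<alpha> \<beta> *\<^sub>R y + a32 \<alpha> \<beta> *\<^sub>R Y1))) Y2"
    unfolding Y2_def mprk_stage_term w2
    by (rule patankar_unique_pos_solution[OF Z w(1)]) (use Y in \<open>simp_all add: Y2_def\<close>)
  have w3: "(\<chi> i. Y1 $ i powr (- (1 / mprk_q \<alpha> \<beta>)) * y $ i powr (1 / mprk_q \<alpha> \<beta> - 1)
      * (beta1 \<alpha> \<beta> *\<^sub>R y + beta2 \<alpha> \<beta> *\<^sub>R Y1) $ i) = w3"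
    using p by (simp add: w3_def vec_eq_iff patankar_weight_eq)
  show "unique_pos_solution (\<lambda>x. x = y + dt *\<^sub>R ((A ** diag x ** diag_powr Y1 (- (1 / mprk_q \<alpha> \<beta>))
      ** diag_powr y (1 / mprk_q \<alpha> \<beta> - 1)) *v (beta1 \<alpha> \<beta> *\<^sub>R y + beta2 \<alpha> \<beta> *\<^sub>R Y1))) Y3"
    unfolding Y3_def mprk_stage_term w3
    by (rule patankar_unique_pos_solution[OF Z w(2)]) (use Y in \<open>simp_all add: Y3_def\<close>)
  have w4: "(\<chi> i. Y3 $ i powr (- 1) * (b1 \<alpha> \<beta> *\<^sub>R y + b2 \<alpha> \<beta> *\<^sub>R Y1 + b3 \<alpha> \<beta> *\<^sub>R Y2) $ i) = w4"
    unfolding w4_def vec_eq_iff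
  proof
    fix i
    show "(\<chi> i. Y3 $ i powr (- 1) * (b1 \<alpha> \<beta> *\<^sub>R y + b2 \<alpha> \<beta> *\<^sub>R Y1 + b3 \<alpha> \<beta> *\<^sub>R Y2) $ i) $ i
      = (\<chi> i. (b1 \<alpha> \<beta> + b2 \<alpha> \<beta> * (Y1 $ i / y $ i) + b3 \<alpha> \<beta> * (Y2 $ i / y $ i)) / (Y3 $ i / y $ i)) $ i"
      using p[of i] by (simp add: powr_minus field_simps)
  qed
  show "unique_pos_solution (\<lambda>x. x = y + dt *\<^sub>R ((A ** diag x ** diag_powr Y3 (- 1))
      *v (b1 \<alpha> \<beta> *\<^sub>R y + b2 \<alpha> \<beta> *\<^sub>R Y1 + b3 \<alpha> \<beta> *\<^sub>R Y2))) Y4"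
    unfolding Y4_def mprk_stage_term w4
    by (rule patankar_unique_pos_solution[OF Z w(3)]) (use Y in \<open>simp_all add: Y4_def\<close>)
qed

text \<open>One step of the scheme at \<open>z + d\<close> is \<open>z + N(Z) D(Z)\<^sup>-\<^sup>1 d + o(d)\<close>, uniformly for equilibria \<open>z\<close> near \<open>ystar\<close>; \<open>L\<close> stands for
  the inverse of \<open>D(Z)\<close>. The four stages are expanded one after the other.\<close>
lemma mprk43_expansion:
  fixes A :: "real ^ 'n ^ 'n"
  assumes Z: "conservative (dt *\<^sub>R A)" and pos: "vpos ystar"
    and \<alpha>: "0 < \<alpha>" "0 < \<beta>" "\<alpha> \<noteq> \<beta>" "\<alpha> \<noteq> 2/3"
    and L: "linear L" "\<And>v. op_poly (dt *\<^sub>R A) (stab_den \<alpha> \<beta>) (L v) = v"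
    and "0 < \<epsilon>"
  obtains r where "0 < r" "\<And>y z. norm (y - ystar) < r \<Longrightarrow> norm (z - ystar) < r \<Longrightarrow> A *v z = 0 \<Longrightarrow>
    \<exists>y'. mprk43_step \<alpha> \<beta> dt A y y' \<and>
      norm (y' - z - op_poly (dt *\<^sub>R A) (stab_num \<alpha> \<beta>) (L (y - z))) \<le> \<epsilon> * norm (y - z)"
proof -
  define Z where "Z = dt *\<^sub>R A"
  note Zc = Z[folded Z_def]
  define F where "F = inf (nhds (ystar, ystar)) (principal {x. A *v snd x = 0})"
  have lim: "(fst \<longlongrightarrow> ystar) F" "(snd \<longlongrightarrow> ystar) F"
  proof -
    have "(fst \<longlongrightarrow> fst (ystar, ystar)) (nhds (ystar, ystar))" "(snd \<longlongrightarrow> snd (ystar, ystar)) (nhds (ystar, ystar))"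
      by (intro tendsto_fst tendsto_snd filterlim_ident)+
    then show "(fst \<longlongrightarrow> ystar) F" "(snd \<longlongrightarrow> ystar) F"
      unfolding F_def by (auto intro: tendsto_mono[OF inf_le1])
  qed
  have kerZ: "eventually (\<lambda>x. Z *v snd x = 0) F"
    unfolding F_def eventually_inf_principal Z_def
    by (simp add: scaleR_matrix_vector_assoc[symmetric])
  interpret perturbed_equilibrium Z F fst snd ystar
    by unfold_locales (fact Zc pos kerZ lim)+
  define h where "h x = L (fst x - snd x)" for x :: "(real ^ 'n) \<times> (real ^ 'n)"
  have h: "big_vec F dist_yz h" "\<And>x. op_poly Z (stab_den \<alpha> \<beta>) (h x) = fst x - snd x"
    using big_vec_linear[OF L(1)] L(2) by (simp_all add: h_def[abs_def] Z_def)
  note eqs = stage_num_equations[OF \<alpha>] and oc = order_conditions[OF \<alpha>]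

  define Y1 where "Y1 x = patankar Z (const_vec \<alpha>) (fst x)" for x :: "(real ^ 'n) \<times> (real ^ 'n)"
  have Y1: "small_vec F dist_yz (\<lambda>x. Y1 x - snd x - op_poly Z (stage1_num \<alpha> \<beta>) (h x))"
    "big_vec F dist_yz (\<lambda>x. op_poly Z (stage1_num \<alpha> \<beta>) (h x))"
  proof -
    have "eventually (\<lambda>x. Y1 x = fst x + Z *v (const_vec \<alpha> * Y1 x)) F"
      unfolding Y1_def by (intro always_eventually allI patankar_eq Zc) (simp add: const_vec_def \<alpha>)
    note * = stage_expansion_poly[of "\<lambda>_. const_vec \<alpha>" \<alpha> Y1 h "stab_den \<alpha> \<beta>" 0 "stage1_num \<alpha> \<beta>",
        OF _ \<alpha>(1) this h _ eqs(1)]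
    show "small_vec F dist_yz (\<lambda>x. Y1 x - snd x - op_poly Z (stage1_num \<alpha> \<beta>) (h x))"
      "big_vec F dist_yz (\<lambda>x. op_poly Z (stage1_num \<alpha> \<beta>) (h x))"
      by (rule *; simp add: const_vec_def small_vec_def)+
  qed
  have diff: "op_poly Z p (h x) - (fst x - snd x) = op_poly Z (p - stab_den \<alpha> \<beta>) (h x)" for p x
    by (simp add: op_poly_diff h(2))

  define w2 where "w2 x = (\<chi> i. patankar_weight (mprk_p \<alpha> \<beta>) (a31 \<alpha> \<beta>) (a32 \<alpha> \<beta>) (Y1 x $ i / fst x $ i))" for x :: "(real ^ 'n) \<times> (real ^ 'n)"
  define Y2 where "Y2 x = patankar Z (w2 x) (fst x)" for x :: "(real ^ 'n) \<times> (real ^ 'n)"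
  have "(patankar_weight (mprk_p \<alpha> \<beta>) (a31 \<alpha> \<beta>) (a32 \<alpha> \<beta>) has_real_derivative - a32 \<alpha> \<beta>) (at 1)"
    using patankar_weight_deriv[of "mprk_p \<alpha> \<beta>" "a31 \<alpha> \<beta>" "a32 \<alpha> \<beta>"] oc(6) by (simp add: oc(5))
  note w2 = weight_expansion[OF Y1 this, unfolded patankar_weight_1 oc(5) diff op_poly_smult[symmetric], folded w2_def]
  have w2pos: "eventually (\<lambda>x. \<forall>i. 0 < w2 x $ i) F"
    by (rule eventually_weight_pos[OF w2(1) \<alpha>(2)])
  then have "eventually (\<lambda>x. Y2 x = fst x + Z *v (w2 x * Y2 x)) F"
    unfolding Y2_def by (rule eventually_mono) (rule patankar_eq[OF Zc])
  note Y2 = stage_expansion_poly[OF w2(1) \<alpha>(2) this h w2(2) eqs(2)]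

  define w3 where "w3 x = (\<chi> i. patankar_weight (mprk_q \<alpha> \<beta>) (beta1 \<alpha> \<beta>) (beta2 \<alpha> \<beta>) (Y1 x $ i / fst x $ i))" for x :: "(real ^ 'n) \<times> (real ^ 'n)"
  define Y3 where "Y3 x = patankar Z (w3 x) (fst x)" for x :: "(real ^ 'n) \<times> (real ^ 'n)"
  have beta: "beta1 \<alpha> \<beta> + beta2 \<alpha> \<beta> = 1"
    by (simp add: beta1_def)
  have "(patankar_weight (mprk_q \<alpha> \<beta>) (beta1 \<alpha> \<beta>) (beta2 \<alpha> \<beta>) has_real_derivative - (1 / (2 * \<alpha>))) (at 1)"
    using patankar_weight_deriv[of "mprk_q \<alpha> \<beta>" "beta1 \<alpha> \<beta>" "beta2 \<alpha> \<beta>"] \<alpha>(1)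
    by (simp add: beta) (simp add: beta2_def mprk_q_def a21_def field_simps)
  note w3 = weight_expansion[OF Y1 this, unfolded patankar_weight_1 beta diff op_poly_smult[symmetric], folded w3_def]
  have w3pos: "eventually (\<lambda>x. \<forall>i. 0 < w3 x $ i) F"
    by (rule eventually_weight_pos[OF w3(1)]) simp
  then have "eventually (\<lambda>x. Y3 x = fst x + Z *v (w3 x * Y3 x)) F"
    unfolding Y3_def by (rule eventually_mono) (rule patankar_eq[OF Zc])
  note Y3 = stage_expansion_poly[OF w3(1) zero_less_one this h w3(2) eqs(3)]

  define w4 where "w4 x = (\<chi> i. (b1 \<alpha> \<beta> + b2 \<alpha> \<beta> * (Y1 x $ i / fst x $ i) + b3 \<alpha> \<beta> * (Y2 x $ i / fst x $ i))
      / (Y3 x $ i / fst x $ i))" for x :: "(real ^ 'n) \<times> (real ^ 'n)"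
  define Y4 where "Y4 x = patankar Z (w4 x) (fst x)" for x :: "(real ^ 'n) \<times> (real ^ 'n)"
  note w4 = final_weight_expansion[OF Y1 Y2 Y3 oc(1), unfolded diff op_poly_smult[symmetric]
      op_poly_add[symmetric] op_poly_diff[symmetric], folded w4_def]
  have w4pos: "eventually (\<lambda>x. \<forall>i. 0 < w4 x $ i) F"
    by (rule eventually_weight_pos[OF w4(1)]) simp
  then have "eventually (\<lambda>x. Y4 x = fst x + Z *v (w4 x * Y4 x)) F"
    unfolding Y4_def by (rule eventually_mono) (rule patankar_eq[OF Zc])
  note Y4 = stage_expansion_poly[OF w4(1) zero_less_one this h w4(2) eqs(4)]

  have "eventually (\<lambda>x. norm (norm (Y4 x - snd x - op_poly Z (stab_num \<alpha> \<beta>) (h x))) \<le> \<epsilon> * norm (dist_yz x)) F"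
    by (rule landau_o.smallD[OF small_vec_norm[OF Y4(1)] \<open>0 < \<epsilon>\<close>])
  then have "eventually (\<lambda>x. mprk43_step \<alpha> \<beta> dt A (fst x) (Y4 x) \<and>
      norm (Y4 x - snd x - op_poly Z (stab_num \<alpha> \<beta>) (h x)) \<le> \<epsilon> * norm (fst x - snd x)) F"
    using w2pos w3pos w4pos eventually_vpos[OF ratio_expansion(1)[OF Y1]] eventually_vpos[OF ratio_expansion(1)[OF Y2]]
      eventually_vpos[OF ratio_expansion(1)[OF Y3]] eventually_vpos[OF ratio_expansion(1)[OF Y4]]
      eventually_vpos[OF y]
  proof eventually_elim
    case (elim x)
    have "mprk43_step \<alpha> \<beta> dt A (fst x) (Y4 x)"
      using elim mprk43_step_patankar[OF assms(1) \<alpha>(1), of "fst x" \<beta>]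
      unfolding Y1_def Y2_def Y3_def Y4_def w2_def w3_def w4_def Z_def by blast
    with elim show ?case by simp
  qed
  then have "eventually (\<lambda>x. A *v snd x = 0 \<longrightarrow> mprk43_step \<alpha> \<beta> dt A (fst x) (Y4 x) \<and>
      norm (Y4 x - snd x - op_poly Z (stab_num \<alpha> \<beta>) (h x)) \<le> \<epsilon> * norm (fst x - snd x)) (nhds (ystar, ystar))"
    unfolding F_def eventually_inf_principal by simp
  then obtain d where d: "0 < d" "\<And>x. dist x (ystar, ystar) < d \<Longrightarrow> A *v snd x = 0 \<Longrightarrow>
      mprk43_step \<alpha> \<beta> dt A (fst x) (Y4 x) \<and>
      norm (Y4 x - snd x - op_poly Z (stab_num \<alpha> \<beta>) (h x)) \<le> \<epsilon> * norm (fst x - snd x)"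
    unfolding eventually_nhds_metric by blast
  show thesis
  proof
    show "0 < d / 2" using d by simp
    fix y z assume yz: "norm (y - ystar) < d / 2" "norm (z - ystar) < d / 2" "A *v z = 0"
    have "dist (y, z) (ystar, ystar) \<le> dist y ystar + dist z ystar"
      unfolding dist_Pair_Pair using sqrt_sum_squares_le_sum[of "dist y ystar" "dist z ystar"] by simp
    also have "\<dots> < d" using yz by (simp add: dist_norm)
    finally have "dist (y, z) (ystar, ystar) < d" .
    from d(2)[OF this] yz(3)
    show "\<exists>y'. mprk43_step \<alpha> \<beta> dt A y y' \<and>
      norm (y' - z - op_poly (dt *\<^sub>R A) (stab_num \<alpha> \<beta>) (L (y - z))) \<le> \<epsilon> * norm (y - z)"
      by (auto simp: h_def Z_def)
  qed
qed

section \<open>Stability and convergence\<close>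

lemma linear_op_poly: "linear (op_poly (Z :: real ^ 'n ^ 'n) p)"
  by (intro linearI) (simp_all add: op_poly_add_right op_poly_scale_right flip: scalar_mult_eq_scaleR)

lemma op_poly_range: "v \<in> range ((*v) M) \<Longrightarrow> op_poly M p v \<in> range ((*v) M)"
  by (auto simp: op_poly_mult_right)

lemma subspace_range_matrix: "subspace (range ((*v) (A :: real ^ 'n ^ 'm)))"
  by (intro linear_subspace_image matrix_vector_mul_linear subspace_UNIV)

text \<open>The matrix \<open>A\<close> is injective on its range, hence a bijection of the range. The projection onto the range along the
  kernel is therefore \<open>A\<close> followed by the inverse of this bijection.\<close>
lemma conservative_splitting:
  fixes A :: "real ^ 'n ^ 'n"
  assumes A: "conservative A"
  obtains Q where "linear Q" "\<And>y. Q y \<in> range ((*v) A)" "\<And>y. A *v Q y = A *v y"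
    "\<forall>v\<in>range ((*v) A). Q v = v"
proof -
  let ?S = "range ((*v) A)"
  have lin: "linear ((*v) A)" by (rule matrix_vector_mul_linear)
  have inj: "inj_on ((*v) A) ?S"
  proof (subst linear_inj_on_iff_eq_0[OF lin subspace_range_matrix], intro ballI impI)
    fix v assume "v \<in> ?S" "A *v v = 0"
    then show "v = 0" using conservative_ker_range[OF A] by auto
  qed
  have "dim ((*v) A ` ?S) = dim ?S"
    by (rule dim_image_eq[OF lin]) (subst span_eq_iff[THEN iffD2, OF subspace_range_matrix], rule inj)
  then have surj: "(*v) A ` ?S = ?S"
    by (intro subspace_dim_equal linear_subspace_image lin subspace_range_matrix) auto
  obtain g where g: "range g \<subseteq> ?S" "linear g" "\<And>v. v \<in> ?S \<Longrightarrow> g (A *v v) = v"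
    using linear_exists_left_inverse_on[OF lin subspace_range_matrix inj] by blast
  define Q where "Q y = g (A *v y)" for y
  show thesis
  proof
    show "linear Q"
      unfolding Q_def using linear_compose[OF lin g(2)] by (simp add: o_def)
    show "Q y \<in> ?S" for y
      using g(1) by (auto simp: Q_def)
    show "A *v Q y = A *v y" for y
    proof -
      obtain d where "d \<in> ?S" "A *v y = A *v d"
        using surj by (metis imageE rangeI)
      then show ?thesis by (simp add: Q_def g(3))
    qed
    show "\<forall>v\<in>?S. Q v = v"
      using g(3) by (simp add: Q_def)
  qed
qed

text \<open>Each linear factor \<open>1 - c X\<close> of the denominator has \<open>c > 0\<close> and is injective at \<open>Z\<close> by the resolvent estimate.\<close>
lemma stab_den_inverse:
  fixes Z :: "real ^ 'n ^ 'n"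
  assumes Z: "conservative Z" and pos: "0 < \<alpha>" "0 < \<beta>"
  obtains L where "linear L" "\<And>v. op_poly Z (stab_den \<alpha> \<beta>) (L v) = v"
    "\<And>v. v \<in> range ((*v) Z) \<Longrightarrow> L v \<in> range ((*v) Z)"
proof -
  have inj1: "v = 0" if "0 < c" "op_poly Z [:1, - c:] v = 0" for c v
  proof (rule l1norm_eq_0)
    have "v - Z *v (const_vec c * v) = 0"
      using that(2) by (simp add: mult_const_vec vec.neg vec.scale)
    from resolvent_l1[OF Z _ this] that(1) show "l1norm v \<le> 0"
      by (simp add: const_vec_def l1norm_def)
  qed
  have "inj (op_poly Z (stab_den \<alpha> \<beta>))"
    unfolding linear_injective_0[OF linear_op_poly]
  proof (intro allI impI)
    fix v assume "op_poly Z (stab_den \<alpha> \<beta>) v = 0"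
    then show "v = 0"
      unfolding stab_den_def op_poly_mult power2_eq_square
      using inj1[OF pos(1)] inj1[OF pos(2)] inj1[OF zero_less_one] by blast
  qed
  then obtain L where L: "linear L" "\<And>v. op_poly Z (stab_den \<alpha> \<beta>) (L v) = v"
    using linear_injective_imp_surjective[OF linear_op_poly] linear_surjective_right_inverse[OF linear_op_poly]
    by (metis comp_apply id_apply)
  show thesis
  proof
    fix v assume v: "v \<in> range ((*v) Z)"
    obtain p where p: "stab_den \<alpha> \<beta> = pCons 1 p"
      by (simp add: stab_den_coeffs)
    have "L v + Z *v op_poly Z p (L v) = v"
      using L(2)[of v] by (simp add: p)
    then have "L v = v - Z *v op_poly Z p (L v)"
      by (simp add: algebra_simps)
    then show "L v \<in> range ((*v) Z)"
      using subspace_diff[OF subspace_range_matrix v] by (metis rangeI)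
  qed (fact L)+
qed

lemma linear_funpow:
  fixes J :: "'a::real_vector \<Rightarrow> 'a"
  assumes "linear J"
  shows "linear (J ^^ k)"
proof (induction k)
  case 0
  show ?case by (simp add: linear_iff)
next
  case (Suc k)
  from linear_compose[OF this assms] show ?case by (simp add: o_def)
qed

lemma power_eventually_half:
  fixes J Q :: "real ^ 'n \<Rightarrow> real ^ 'n"
  assumes J: "linear J" and Q: "linear Q" and lim: "\<And>v. (\<lambda>m. (J ^^ m) (Q v)) \<longlonglongrightarrow> 0"
  obtains m where "1 \<le> m" "\<And>v. norm ((J ^^ m) (Q v)) \<le> norm v / 2"
proof -
  have linp: "linear (J ^^ m)" for m
    by (rule linear_funpow[OF J])
  have "(\<lambda>m. \<Sum>i\<in>UNIV. norm ((J ^^ m) (Q (axis i 1)))) \<longlonglongrightarrow> (\<Sum>i\<in>(UNIV :: 'n set). 0)"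
    by (intro tendsto_sum tendsto_norm_zero lim)
  then have "\<forall>\<^sub>F m in sequentially. (\<Sum>i\<in>UNIV. norm ((J ^^ m) (Q (axis i 1)))) < 1/2 \<and> 1 \<le> m"
    by (intro eventually_conj order_tendstoD eventually_ge_at_top) auto
  then obtain m where m: "(\<Sum>i\<in>UNIV. norm ((J ^^ m) (Q (axis i 1)))) < 1/2" "1 \<le> m"
    by (auto dest: eventually_happens)
  have "norm ((J ^^ m) (Q v)) \<le> norm v / 2" for v
  proof -
    have lin: "linear (\<lambda>v. (J ^^ m) (Q v))"
      using linear_compose[OF Q linp] by (simp add: o_def)
    have "(J ^^ m) (Q v) = (J ^^ m) (Q (\<Sum>i\<in>UNIV. v $ i *\<^sub>R axis i 1))"
      by (simp add: basis_expansion flip: scalar_mult_eq_scaleR)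
    also have "\<dots> = (\<Sum>i\<in>UNIV. v $ i *\<^sub>R (J ^^ m) (Q (axis i 1)))"
      by (simp add: linear_sum[OF lin] linear_scale[OF lin])
    also have "norm \<dots> \<le> (\<Sum>i\<in>UNIV. norm v * norm ((J ^^ m) (Q (axis i 1))))"
      by (intro order.trans[OF norm_sum] sum_mono)
         (auto intro!: mult_right_mono simp: component_le_norm_cart)
    also have "\<dots> \<le> norm v * (1/2)"
      unfolding sum_distrib_left[symmetric] using m by (intro mult_left_mono) auto
    finally show ?thesis by simp
  qed
  with m(2) that show thesis by blast
qed

text \<open>If the \<open>m\<close>-th power of \<open>J\<close> halves norms, then the sum of \<open>norm ((J ^^ k) v)\<close> over \<open>k < m\<close> loses at least
  \<open>norm v / 2\<close> under \<open>J\<close>, which is a fixed proportion of it.\<close>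
lemma adapted_norm:
  fixes J Q :: "real ^ 'n \<Rightarrow> real ^ 'n"
  assumes J: "linear J" and Q: "linear Q" and lim: "\<And>v. (\<lambda>m. (J ^^ m) (Q v)) \<longlonglongrightarrow> 0"
  obtains \<nu> :: "real ^ 'n \<Rightarrow> real" and K q where "1 \<le> K" "0 \<le> q" "q < 1"
    "\<And>v. norm v \<le> \<nu> v" "\<And>v. \<nu> v \<le> K * norm v" "\<And>v w. \<nu> (v + w) \<le> \<nu> v + \<nu> w"
    "\<And>v. Q v = v \<Longrightarrow> \<nu> (J v) \<le> q * \<nu> v"
proof -
  obtain m where m: "1 \<le> m" "\<And>v. norm ((J ^^ m) (Q v)) \<le> norm v / 2"
    using power_eventually_half[OF assms] by blast
  have linp: "linear (J ^^ k)" for k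
    by (rule linear_funpow[OF J])
  have "\<exists>B. \<forall>v. norm ((J ^^ k) v) \<le> norm v * B" for k
    using linp[of k] linear_conv_bounded_linear bounded_linear.bounded by blast
  then obtain B where B: "\<And>k v. norm ((J ^^ k) v) \<le> norm v * B k"
    by metis
  define \<nu> where "\<nu> v = (\<Sum>k<m. norm ((J ^^ k) v))" for v
  define K where "K = max 1 (\<Sum>k<m. B k)"
  have K: "1 \<le> K" by (simp add: K_def)
  have le: "\<nu> v \<le> K * norm v" for v
  proof -
    have "\<nu> v \<le> (\<Sum>k<m. norm v * B k)"
      unfolding \<nu>_def by (intro sum_mono B)
    also have "\<dots> = (\<Sum>k<m. B k) * norm v"
      unfolding sum_distrib_right by (intro sum.cong) auto
    also have "\<dots> \<le> K * norm v"
      by (intro mult_right_mono) (auto simp: K_def)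
    finally show ?thesis .
  qed
  show thesis
  proof
    show "norm v \<le> \<nu> v" for v
    proof -
      have "norm ((J ^^ 0) v) \<le> \<nu> v"
        unfolding \<nu>_def using m(1) by (intro member_le_sum) auto
      then show ?thesis by simp
    qed
    show "\<nu> (v + w) \<le> \<nu> v + \<nu> w" for v w
      unfolding \<nu>_def sum.distrib[symmetric]
      by (intro sum_mono) (simp add: linear_add[OF linp] norm_triangle_ineq)
    show "\<nu> (J v) \<le> (1 - 1 / (2 * K)) * \<nu> v" if "Q v = v" for v
    proof -
      have "\<nu> (J v) = (\<Sum>k<m. norm ((J ^^ Suc k) v))"
        by (simp add: \<nu>_def funpow_swap1)
      also have "\<dots> = \<nu> v - norm v + norm ((J ^^ m) v)"
        unfolding \<nu>_def using sum.lessThan_Suc_shift[of "\<lambda>k. norm ((J ^^ k) v)" m]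
        by simp
      also have "\<dots> \<le> \<nu> v - norm v / 2"
        using m(2)[of v] that by simp
      also have "\<dots> \<le> \<nu> v - \<nu> v / K / 2"
        using le[of v] K by (simp add: field_simps)
      finally show ?thesis by (simp add: algebra_simps)
    qed
    show "0 \<le> 1 - 1 / (2 * K)" "1 - 1 / (2 * K) < 1"
      using K by (auto simp: field_simps)
  qed (fact K le)+
qed

lemma mprk43_step_conserves:
  assumes "mprk43_step \<alpha> \<beta> dt A y y'"
  shows "y' - y \<in> range ((*v) A)"
proof -
  obtain y1 y2 y3 where "unique_pos_solution
      (\<lambda>x. x = y + dt *\<^sub>R ((A ** diag x ** diag_powr y3 (- 1))
         *v (b1 \<alpha> \<beta> *\<^sub>R y + b2 \<alpha> \<beta> *\<^sub>R y1 + b3 \<alpha> \<beta> *\<^sub>R y2))) y'"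
    using assms unfolding mprk43_step_def by blast
  then have "y' - y = dt *\<^sub>R ((A ** diag y' ** diag_powr y3 (- 1))
         *v (b1 \<alpha> \<beta> *\<^sub>R y + b2 \<alpha> \<beta> *\<^sub>R y1 + b3 \<alpha> \<beta> *\<^sub>R y2))"
    unfolding unique_pos_solution_def by (metis add_diff_cancel_left')
  also have "\<dots> = A *v (dt *\<^sub>R (diag y' *v (diag_powr y3 (- 1)
         *v (b1 \<alpha> \<beta> *\<^sub>R y + b2 \<alpha> \<beta> *\<^sub>R y1 + b3 \<alpha> \<beta> *\<^sub>R y2))))"
    by (simp only: matrix_vector_mult_scaleR matrix_vector_mul_assoc[symmetric])
  finally show ?thesis by blast
qed

lemma stability_operator_power_tendsto_0:
  fixes Z :: "real ^ 'n ^ 'n"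
  assumes card: "CARD('n) \<le> 4" and Z: "conservative Z"
    and ab: "1/3 \<le> \<alpha>" "0 < \<beta>" "\<alpha> / 2 - 1/6 \<le> 2 * (\<alpha> * \<beta>)"
    and L: "\<And>v. op_poly Z (stab_den \<alpha> \<beta>) (L v) = v"
      "\<And>v. v \<in> range ((*v) Z) \<Longrightarrow> L v \<in> range ((*v) Z)"
    and v: "v \<in> range ((*v) Z)"
  shows "(\<lambda>n. ((\<lambda>v. op_poly Z (stab_num \<alpha> \<beta>) (L v)) ^^ n) v) \<longlonglongrightarrow> 0"
proof -
  define J where "J v = op_poly Z (stab_num \<alpha> \<beta>) (L v)" for v
  have range: "(J ^^ n) v \<in> range ((*v) Z)" for n
    by (induction n) (auto simp: v J_def intro!: op_poly_range L(2))
  have "(\<lambda>n. L ((J ^^ n) v)) \<longlonglongrightarrow> 0"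
  proof (rule stability_recurrence_tendsto_0[OF card Z ab])
    show "op_poly Z (stab_den \<alpha> \<beta>) (L ((J ^^ Suc n) v)) = op_poly Z (stab_num \<alpha> \<beta>) (L ((J ^^ n) v))" for n
      by (simp add: L(1)) (simp add: J_def)
  qed (rule L(2)[OF range])
  then have "(\<lambda>n. op_poly Z (stab_den \<alpha> \<beta>) (L ((J ^^ n) v))) \<longlonglongrightarrow> 0"
    using bounded_linear.tendsto_zero linear_op_poly linear_conv_bounded_linear by blast
  then show ?thesis
    by (simp add: L(1) J_def[abs_def])
qed

text \<open>The error of the linearization is chosen so small in comparison with the gap \<open>1 - q\<close> that a step still contracts
  the adapted norm of \<open>y - z\<close>, by the factor \<open>(1 + q) / 2\<close>. Here \<open>z = y0 - Q y0\<close> is the equilibrium with the same linear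
  invariants as \<open>y0\<close>; its distance from \<open>ystar\<close> is controlled by that of \<open>y0\<close>, as \<open>ystar\<close> is fixed by the projection to the kernel.\<close>
lemma mprk43_orbits:
  fixes A :: "real ^ 'n ^ 'n"
  assumes card: "CARD('n) \<le> 4" and A: "standing_assumptions A" and adm: "admissible \<alpha> \<beta>"
    and pos: "vpos ystar" and ker: "A *v ystar = 0" and dt: "0 < dt"
    and Q: "linear Q" "\<And>y. Q y \<in> range ((*v) A)" "\<And>y. A *v Q y = A *v y"
      "\<forall>v\<in>range ((*v) A). Q v = v"
  shows "\<exists>q C \<delta>. 0 \<le> q \<and> q < 1 \<and> 0 \<le> C \<and> 0 < \<delta> \<and>
    (\<forall>y0. norm (y0 - Q y0 - ystar) \<le> C * norm (y0 - ystar)) \<and>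
    (\<forall>y0 n. norm (y0 - ystar) < \<delta> \<longrightarrow> (mprk43_map \<alpha> \<beta> dt A ^^ n) y0 \<in> mprk43_dom \<alpha> \<beta> dt A \<and>
      norm ((mprk43_map \<alpha> \<beta> dt A ^^ n) y0 - (y0 - Q y0)) \<le> q ^ n * (C * norm (y0 - ystar)))"
proof -
  define Z where "Z = dt *\<^sub>R A"
  have Ac: "conservative A" and Zc: "conservative Z"
    using standing_assumptions_conservative[OF A, of 1] standing_assumptions_conservative[OF A, of dt] dt
    by (simp_all add: Z_def)
  have rangeZ: "range ((*v) Z) = range ((*v) A)"
  proof -
    have "Z *v u = A *v (dt *\<^sub>R u)" "A *v u = Z *v ((1 / dt) *\<^sub>R u)" for u
      using dt by (simp_all add: Z_def matrix_vector_mult_scaleR scaleR_matrix_vector_assoc[symmetric])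
    then show ?thesis by (metis (no_types, lifting) image_cong image_subsetI rangeI subset_antisym)
  qed
  note ab = admissible_bounds[OF adm]
  have \<alpha>: "0 < \<alpha>" using ab(1) by simp
  obtain L where L: "linear L" "\<And>v. op_poly Z (stab_den \<alpha> \<beta>) (L v) = v"
    "\<And>v. v \<in> range ((*v) Z) \<Longrightarrow> L v \<in> range ((*v) Z)"
    using stab_den_inverse[OF Zc \<alpha> ab(2)] by blast
  define J where "J v = op_poly Z (stab_num \<alpha> \<beta>) (L v)" for v
  have J: "linear J"
    using linear_compose[OF L(1) linear_op_poly] by (simp add: J_def[abs_def] o_def)
  have lim: "(\<lambda>m. (J ^^ m) (Q v)) \<longlonglongrightarrow> 0" for v
    unfolding J_def[abs_def]
    by (rule stability_operator_power_tendsto_0[OF card Zc ab(1-3) L(2,3)]) (simp_all add: rangeZ Q(2))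
  obtain \<nu> :: "real ^ 'n \<Rightarrow> real" and K q where \<nu>: "1 \<le> K" "0 \<le> q" "q < 1"
    "\<And>v. norm v \<le> \<nu> v" "\<And>v. \<nu> v \<le> K * norm v" "\<And>v w. \<nu> (v + w) \<le> \<nu> v + \<nu> w"
    "\<And>v. Q v = v \<Longrightarrow> \<nu> (J v) \<le> q * \<nu> v"
    by (rule adapted_norm[OF J Q(1) lim]) (rule that)
  define q' where "q' = (1 + q) / 2"
  have q': "0 \<le> q'" "q' < 1" using \<nu> by (auto simp: q'_def)
  \<comment> \<open>With this tolerance \<open>q + K \<epsilon>\<close> equals the midpoint \<open>q'\<close> of \<open>q\<close> and 1.\<close>
  define \<epsilon> where "\<epsilon> = (1 - q) / (2 * K)"
  have "0 < \<epsilon>" using \<nu> by (simp add: \<epsilon>_def)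
  obtain r where r: "0 < r" "\<And>y z. norm (y - ystar) < r \<Longrightarrow> norm (z - ystar) < r \<Longrightarrow> A *v z = 0 \<Longrightarrow>
    \<exists>y'. mprk43_step \<alpha> \<beta> dt A y y' \<and> norm (y' - z - op_poly (dt *\<^sub>R A) (stab_num \<alpha> \<beta>) (L (y - z))) \<le> \<epsilon> * norm (y - z)"
    by (rule mprk43_expansion[OF Zc[unfolded Z_def] pos \<alpha> ab(2,4,5) L(1) L(2)[unfolded Z_def] \<open>0 < \<epsilon>\<close>]) (rule that)
  note expand = r(2)[folded Z_def, folded J_def]
  have contract: "\<exists>y'. mprk43_step \<alpha> \<beta> dt A y y' \<and> y' - z \<in> range ((*v) A) \<and> \<nu> (y' - z) \<le> q' * \<nu> (y - z)"
    if yz: "norm (y - ystar) < r" "norm (z - ystar) < r" "A *v z = 0" "y - z \<in> range ((*v) A)" for y z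
  proof -
    obtain y' where y': "mprk43_step \<alpha> \<beta> dt A y y'" "norm (y' - z - J (y - z)) \<le> \<epsilon> * norm (y - z)"
      using expand[OF yz(1-3)] by blast
    have "\<nu> (y' - z) \<le> \<nu> (J (y - z)) + \<nu> (y' - z - J (y - z))"
      using \<nu>(6)[of "J (y - z)" "y' - z - J (y - z)"] by simp
    also have "\<dots> \<le> q * \<nu> (y - z) + K * (\<epsilon> * norm (y - z))"
    proof (rule add_mono[OF \<nu>(7)[OF Q(4)[rule_format, OF yz(4)]]], rule order.trans[OF \<nu>(5)])
      show "K * norm (y' - z - J (y - z)) \<le> K * (\<epsilon> * norm (y - z))"
        using \<nu>(1) y'(2) by (intro mult_left_mono) auto
    qed
    also have "\<dots> \<le> q * \<nu> (y - z) + K * (\<epsilon> * \<nu> (y - z))"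
      using \<nu>(1) \<open>0 < \<epsilon>\<close> by (intro add_left_mono mult_left_mono \<nu>(4)) auto
    also have "\<dots> = q' * \<nu> (y - z)"
      using \<nu>(1) by (simp add: \<epsilon>_def q'_def field_simps)
    finally have "\<nu> (y' - z) \<le> q' * \<nu> (y - z)" .
    moreover have "(y' - y) + (y - z) \<in> range ((*v) A)"
      by (intro subspace_add subspace_range_matrix mprk43_step_conserves[OF y'(1)] yz(4))
    ultimately show ?thesis using y'(1) by auto
  qed
  have orbit: "(mprk43_map \<alpha> \<beta> dt A ^^ n) y0 - z \<in> range ((*v) A) \<and>
      \<nu> ((mprk43_map \<alpha> \<beta> dt A ^^ n) y0 - z) \<le> q' ^ n * \<nu> (y0 - z) \<and>
      (mprk43_map \<alpha> \<beta> dt A ^^ n) y0 \<in> mprk43_dom \<alpha> \<beta> dt A"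
    if z: "A *v z = 0" "norm (z - ystar) < r / 2" "y0 - z \<in> range ((*v) A)" "K * norm (y0 - z) < r / 2"
    for y0 z n
  proof -
    have near: "\<exists>y'. mprk43_step \<alpha> \<beta> dt A y y' \<and> y' - z \<in> range ((*v) A) \<and> \<nu> (y' - z) \<le> q' * \<nu> (y - z)"
      if y: "y - z \<in> range ((*v) A)" "\<nu> (y - z) \<le> q' ^ n * \<nu> (y0 - z)" for y n
    proof (rule contract)
      have "norm (y - z) \<le> 1 * \<nu> (y0 - z)"
        using \<nu>(4)[of "y - z"] y(2) mult_right_mono[OF power_le_one[of q' n], of "\<nu> (y0 - z)"] q'
          order.trans[OF norm_ge_zero \<nu>(4)[of "y0 - z"]] by linarith
      then have "norm (y - z) < r / 2"
        using \<nu>(5)[of "y0 - z"] z(4) by simp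
      then show "norm (y - ystar) < r"
        using norm_triangle_ineq[of "y - z" "z - ystar"] z(2) by simp
      show "norm (z - ystar) < r" using z(2) r(1) by simp
    qed (fact z(1) y(1))+
    have main: "(mprk43_map \<alpha> \<beta> dt A ^^ n) y0 - z \<in> range ((*v) A) \<and>
      \<nu> ((mprk43_map \<alpha> \<beta> dt A ^^ n) y0 - z) \<le> q' ^ n * \<nu> (y0 - z)" for n
    proof (induction n)
      case 0
      show ?case using z(3) by simp
    next
      case (Suc n)
      define y where "y = (mprk43_map \<alpha> \<beta> dt A ^^ n) y0"
      obtain y' where y': "mprk43_step \<alpha> \<beta> dt A y y'" "y' - z \<in> range ((*v) A)" "\<nu> (y' - z) \<le> q' * \<nu> (y - z)"
        using near[of y n] Suc.IH unfolding y_def by blast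
      have "(mprk43_map \<alpha> \<beta> dt A ^^ Suc n) y0 = y'"
        using mprk43_map_eqI[OF y'(1)] by (simp add: y_def)
      moreover have "q' * \<nu> (y - z) \<le> q' * (q' ^ n * \<nu> (y0 - z))"
        using Suc.IH q'(1) unfolding y_def by (intro mult_left_mono) auto
      ultimately show ?case
        using y'(2,3) by simp
    qed
    then show ?thesis
      using near[of "(mprk43_map \<alpha> \<beta> dt A ^^ n) y0" n] unfolding mprk43_dom_def by blast
  qed
  obtain B where B: "\<And>v. norm (Q v) \<le> norm v * B" "0 < B"
    using Q(1) linear_conv_bounded_linear bounded_linear.pos_bounded by blast
  have Qstar: "Q ystar = 0"
  proof -
    obtain u where "Q ystar = A *v u" using Q(2) by blast
    then show ?thesis
      using conservative_ker_range[OF Ac _ , of "Q ystar" u] Q(3)[of ystar] ker by simp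
  qed
  then have Qd: "Q y = Q (y - ystar)" for y
    by (simp add: linear_diff[OF Q(1)])
  define C where "C = 1 + K * B"
  have C: "1 \<le> C" "1 + B \<le> C"
    using \<nu>(1) B(2) by (simp_all add: C_def)
  have zb: "norm (y0 - Q y0 - ystar) \<le> C * norm (y0 - ystar)" for y0
  proof -
    have "norm (y0 - Q y0 - ystar) \<le> norm (y0 - ystar) + norm (Q (y0 - ystar))"
      using norm_triangle_ineq4[of "y0 - ystar" "Q (y0 - ystar)"] Qd[of y0] by (simp add: algebra_simps)
    also have "\<dots> \<le> (1 + B) * norm (y0 - ystar)"
      using B(1)[of "y0 - ystar"] by (simp add: algebra_simps)
    also have "\<dots> \<le> C * norm (y0 - ystar)"
      by (intro mult_right_mono C) simp
    finally show ?thesis .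
  qed
  have db: "K * norm (Q y0) \<le> C * norm (y0 - ystar)" for y0
  proof -
    have "K * norm (Q y0) \<le> K * (norm (y0 - ystar) * B)"
      using \<nu>(1) B(1)[of "y0 - ystar"] Qd[of y0] by (intro mult_left_mono) auto
    moreover have "C * norm (y0 - ystar) = norm (y0 - ystar) + K * (norm (y0 - ystar) * B)"
      by (simp add: C_def algebra_simps)
    ultimately show ?thesis
      using norm_ge_zero[of "y0 - ystar"] by linarith
  qed
  show ?thesis
  proof (rule exI[of _ q'], rule exI[of _ C], rule exI[of _ "r / (2 * C)"], intro conjI allI impI)
    show "0 \<le> q'" "q' < 1" "0 \<le> C" "0 < r / (2 * C)"
      using q' C r(1) by auto
    show "norm (y0 - Q y0 - ystar) \<le> C * norm (y0 - ystar)" for y0 by (rule zb)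
    fix y0 n assume "norm (y0 - ystar) < r / (2 * C)"
    then have small: "C * norm (y0 - ystar) < r / 2"
      using C by (simp add: field_simps)
    define z where "z = y0 - Q y0"
    have "A *v z = 0" "y0 - z = Q y0"
      by (simp_all add: z_def matrix_vector_mult_diff_distrib Q(3))
    then have o: "\<nu> ((mprk43_map \<alpha> \<beta> dt A ^^ n) y0 - z) \<le> q' ^ n * \<nu> (Q y0)"
      "(mprk43_map \<alpha> \<beta> dt A ^^ n) y0 \<in> mprk43_dom \<alpha> \<beta> dt A"
      using orbit[of z y0 n] zb[of y0] db[of y0] small Q(2) by (auto simp: z_def)
    have "norm ((mprk43_map \<alpha> \<beta> dt A ^^ n) y0 - z) \<le> q' ^ n * (C * norm (y0 - ystar))"
      using \<nu>(4)[of "(mprk43_map \<alpha> \<beta> dt A ^^ n) y0 - z"] o(1) \<nu>(5)[of "Q y0"] db[of y0]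
        mult_left_mono[of "\<nu> (Q y0)" "C * norm (y0 - ystar)" "q' ^ n"] q'(1) by fastforce
    with o(2) show "(mprk43_map \<alpha> \<beta> dt A ^^ n) y0 \<in> mprk43_dom \<alpha> \<beta> dt A"
      and "norm ((mprk43_map \<alpha> \<beta> dt A ^^ n) y0 - (y0 - Q y0)) \<le> q' ^ n * (C * norm (y0 - ystar))"
      by (simp_all add: z_def)
  qed
qed

theorem corollary3p6:
  fixes A :: "real ^ 'n ^ 'n" and \<alpha> \<beta> :: real
  assumes "CARD('n) \<le> 4"
    and "standing_assumptions A"
    and "admissible \<alpha> \<beta>"
    and "d3 \<alpha> \<beta> * d4 \<alpha> \<beta> - n3 \<alpha> \<beta> * n4 \<alpha> \<beta> \<le> 0"
    and "(n3 \<alpha> \<beta>)\<^sup>2 - (d3 \<alpha> \<beta>)\<^sup>2 \<le> 0"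
    and "n1 \<alpha> \<beta> * n4 \<alpha> \<beta> - n2 \<alpha> \<beta> * n3 \<alpha> \<beta> - d1 \<alpha> \<beta> * d4 \<alpha> \<beta> + d2 \<alpha> \<beta> * d3 \<alpha> \<beta> \<le> 0"
    and "(n2 \<alpha> \<beta>)\<^sup>2 - (d2 \<alpha> \<beta>)\<^sup>2 - 2 * n4 \<alpha> \<beta> + 2 * d4 \<alpha> \<beta> \<le> 0"
    and "- n1 \<alpha> \<beta> * n2 \<alpha> \<beta> + d1 \<alpha> \<beta> * d2 \<alpha> \<beta> + n3 \<alpha> \<beta> - d3 \<alpha> \<beta> \<le> 0"
  shows
    "(\<forall>ystar. vpos ystar \<and> A *v ystar = 0 \<longrightarrow>
        (\<forall>dt>0. stable_fixed_point (mprk43_dom \<alpha> \<beta> dt A) (mprk43_map \<alpha> \<beta> dt A) ystar))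
     \<and>
     (\<forall>ystar. vpos ystar \<longrightarrow>
        (\<forall>dt>0. \<exists>\<delta>>0. \<forall>y0.
           vpos y0 \<and> ivp_steady_state A y0 ystar \<and> norm (y0 - ystar) < \<delta> \<longrightarrow>
             (\<forall>n. (mprk43_map \<alpha> \<beta> dt A ^^ n) y0 \<in> mprk43_dom \<alpha> \<beta> dt A) \<and>
             (\<lambda>n. (mprk43_map \<alpha> \<beta> dt A ^^ n) y0) \<longlonglongrightarrow> ystar))"
proof -
  have Ac: "conservative A"
    using standing_assumptions_conservative[OF assms(2), of 1] by simp
  obtain Q where Q: "linear Q" "\<And>y. Q y \<in> range ((*v) A)" "\<And>y. A *v Q y = A *v y"
    "\<forall>v\<in>range ((*v) A). Q v = v"
    using conservative_splitting[OF Ac] by blast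
  show ?thesis
  proof (intro conjI allI impI)
    fix ystar :: "real ^ 'n" and dt :: real
    assume ystar: "vpos ystar \<and> A *v ystar = 0" and dt: "0 < dt"
    obtain q C \<delta> where q: "0 \<le> q" "q < 1" "0 \<le> C" "0 < \<delta>"
      and z: "\<And>y0. norm (y0 - Q y0 - ystar) \<le> C * norm (y0 - ystar)"
      and orb: "\<And>y0 n. norm (y0 - ystar) < \<delta> \<Longrightarrow> (mprk43_map \<alpha> \<beta> dt A ^^ n) y0 \<in> mprk43_dom \<alpha> \<beta> dt A \<and>
        norm ((mprk43_map \<alpha> \<beta> dt A ^^ n) y0 - (y0 - Q y0)) \<le> q ^ n * (C * norm (y0 - ystar))"
      using mprk43_orbits[OF assms(1-3) conjunct1[OF ystar] conjunct2[OF ystar] dt Q] by (elim exE conjE) blast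
    have Qstar: "ystar - Q ystar = ystar"
      using z[of ystar] by simp
    show "stable_fixed_point (mprk43_dom \<alpha> \<beta> dt A) (mprk43_map \<alpha> \<beta> dt A) ystar"
      unfolding stable_fixed_point_def
    proof (intro conjI allI impI)
      show "ystar \<in> mprk43_dom \<alpha> \<beta> dt A"
        using orb[of ystar 0] q by simp
      show "mprk43_map \<alpha> \<beta> dt A ystar = ystar"
        using orb[of ystar 1] q Qstar by simp
      fix \<epsilon> :: real assume "0 < \<epsilon>"
      show "\<exists>\<delta>>0. \<forall>y0. norm (y0 - ystar) < \<delta> \<longrightarrow> (\<forall>n. (mprk43_map \<alpha> \<beta> dt A ^^ n) y0 \<in> mprk43_dom \<alpha> \<beta> dt A \<and>
        norm ((mprk43_map \<alpha> \<beta> dt A ^^ n) y0 - ystar) < \<epsilon>)"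
      proof (intro exI conjI allI impI)
        show "0 < min \<delta> (\<epsilon> / (2 * C + 1))"
          using q \<open>0 < \<epsilon>\<close> by simp
        fix y0 n assume y0: "norm (y0 - ystar) < min \<delta> (\<epsilon> / (2 * C + 1))"
        show "(mprk43_map \<alpha> \<beta> dt A ^^ n) y0 \<in> mprk43_dom \<alpha> \<beta> dt A"
          using orb y0 by simp
        have "norm ((mprk43_map \<alpha> \<beta> dt A ^^ n) y0 - ystar)
          \<le> norm ((mprk43_map \<alpha> \<beta> dt A ^^ n) y0 - (y0 - Q y0)) + norm (y0 - Q y0 - ystar)"
          using norm_triangle_ineq[of "(mprk43_map \<alpha> \<beta> dt A ^^ n) y0 - (y0 - Q y0)" "y0 - Q y0 - ystar"] by simp
        also have "\<dots> \<le> q ^ n * (C * norm (y0 - ystar)) + C * norm (y0 - ystar)"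
          using orb[of y0 n] y0 z[of y0] by simp
        also have "\<dots> \<le> 1 * (C * norm (y0 - ystar)) + C * norm (y0 - ystar)"
          using q by (intro add_right_mono mult_right_mono power_le_one) auto
        also have "\<dots> \<le> (2 * C + 1) * norm (y0 - ystar)"
          by (simp add: algebra_simps)
        also have "\<dots> < \<epsilon>"
          using y0 q by (simp add: field_simps)
        finally show "norm ((mprk43_map \<alpha> \<beta> dt A ^^ n) y0 - ystar) < \<epsilon>" .
      qed
    qed
  next
    fix ystar :: "real ^ 'n" and dt :: real
    assume ystar: "vpos ystar" and dt: "0 < dt"
    show "\<exists>\<delta>>0. \<forall>y0. vpos y0 \<and> ivp_steady_state A y0 ystar \<and> norm (y0 - ystar) < \<delta> \<longrightarrow>
             (\<forall>n. (mprk43_map \<alpha> \<beta> dt A ^^ n) y0 \<in> mprk43_dom \<alpha> \<beta> dt A) \<and>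
             (\<lambda>n. (mprk43_map \<alpha> \<beta> dt A ^^ n) y0) \<longlonglongrightarrow> ystar"
    proof (cases "A *v ystar = 0")
      case False
      have "A *v ystar = 0" if "ivp_steady_state A y0 ystar" for y0
        by (rule conjunct1[OF iffD2[OF that[unfolded ivp_steady_state_def, THEN spec] refl]])
      with False have "\<not> ivp_steady_state A y0 ystar" for y0
        by metis
      then show ?thesis
        by (intro exI[of _ 1]) simp
    next
      case True
      obtain q C \<delta> where q: "0 \<le> q" "q < 1" "0 \<le> C" "0 < \<delta>"
        and orb: "\<And>y0 n. norm (y0 - ystar) < \<delta> \<Longrightarrow> (mprk43_map \<alpha> \<beta> dt A ^^ n) y0 \<in> mprk43_dom \<alpha> \<beta> dt A \<and>
          norm ((mprk43_map \<alpha> \<beta> dt A ^^ n) y0 - (y0 - Q y0)) \<le> q ^ n * (C * norm (y0 - ystar))"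
        using mprk43_orbits[OF assms(1-3) ystar True dt Q] by (elim exE conjE) blast
      show ?thesis
      proof (intro exI conjI allI impI)
        show "0 < \<delta>" by fact
        fix y0 assume "vpos y0 \<and> ivp_steady_state A y0 ystar \<and> norm (y0 - ystar) < \<delta>"
        then have steady: "ivp_steady_state A y0 ystar" and y0: "norm (y0 - ystar) < \<delta>"
          by simp_all
        show "(mprk43_map \<alpha> \<beta> dt A ^^ n) y0 \<in> mprk43_dom \<alpha> \<beta> dt A" for n
          using orb y0 by blast
        have inv: "n \<bullet> (y0 - Q y0) = n \<bullet> y0" if "transpose A *v n = 0" for n
        proof -
          obtain u where "Q y0 = A *v u" using Q(2) by blast
          then have "n \<bullet> Q y0 = 0"
            using that dot_lmul_matrix[of n A u] by simp
          then show ?thesis by (simp add: inner_diff_right)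
        qed
        have "A *v (y0 - Q y0) = 0"
          by (simp add: matrix_vector_mult_diff_distrib Q(3))
        then have "A *v (y0 - Q y0) = 0 \<and>
            (\<forall>n. transpose A *v n = 0 \<longrightarrow> n \<bullet> (y0 - Q y0) = n \<bullet> y0)"
          by (intro conjI allI impI inv)
        then have "y0 - Q y0 = ystar"
          by (rule iffD1[OF steady[unfolded ivp_steady_state_def, THEN spec]])
        then have bound: "norm ((mprk43_map \<alpha> \<beta> dt A ^^ n) y0 - ystar) \<le> q ^ n * (C * norm (y0 - ystar))" for n
          using orb[of y0 n] y0 by simp
        have "(\<lambda>n. q ^ n * (C * norm (y0 - ystar))) \<longlonglongrightarrow> 0"
          using q by (intro tendsto_mult_left_zero LIMSEQ_realpow_zero) auto
        then have "(\<lambda>n. (mprk43_map \<alpha> \<beta> dt A ^^ n) y0 - ystar) \<longlonglongrightarrow> 0"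
          by (rule Lim_null_comparison[OF always_eventually[OF allI[OF bound]]])
        then show "(\<lambda>n. (mprk43_map \<alpha> \<beta> dt A ^^ n) y0) \<longlonglongrightarrow> ystar"
          by (simp add: LIM_zero_iff)
      qed
    qed
  qed
qed

end
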